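(* Let $\emptyset \ne \mathcal{D} \subset \mathcal{A}$, let $K = R(\mathcal{D}^{\mathbb{N}})$, and let $p = (p(x))_{x \in \mathcal{D}}$ be the probability vector $$p(x) = \frac1Z \prod_{i=1}^s Z^{(i)}(\tau_i(x))^{\alpha_i - 1}, \qquad x \in \mathcal{D}.$$ If $$1 \le \#\{1 \le i \le s : \tau_i p \text{ is not uniform}\} \le 2,$$ then $\mathcal{H}^{\dim_{\mathrm H} K}(K) = \infty$.
   Context: Let $d \ge 1$, let $m_1 \ge \cdots \ge m_d \ge 2$ be integers, $\Lambda = \operatorname{diag}(m_1,\ldots,m_d)$, $\mathbb{T}^d = \mathbb{R}^d/\mathbb{Z}^d$, $\mathcal{A} = \prod_{j=1}^d \{0,\ldots,m_j-1\}$, and define $R \colon \mathcal{A}^{\mathbb{N}} \to \mathbb{T}^d$ by $R(x) = \sum_{k=1}^\infty \Lambda^{-k} x_k$ (mod $\mathbb{Z}^d$). Let $s = \#\{m_1,\ldots,m_d\}$ and let $n_1 > \cdots > n_s$ and $0 = d_0 < d_1 < \cdots < d_s = d$ be the integers with $m_j = n_i$ for $d_{i-1} < j \le d_i$. Put $n_0 = \infty$ and $\alpha_i = \log n_i/\log n_{i-1}$ for $1 \le i \le s$ (so $\alpha_1 = 0$). For $1 \le i \le s$ let $\tau_i$ be the projection $(x_1,\ldots,x_d) \mapsto (x_{d_{i-1}+1},\ldots,x_d)$ on $\mathcal{A}$, and let $\mathcal{D}_i = \tau_i(\mathcal{D})$ (so $\tau_1$ is the identity and $\mathcal{D}_1 =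 \mathcal{D}$). For $2 \le i \le s$ let $\pi_i \colon \mathcal{D}_{i-1} \to \mathcal{D}_i$ be the projection deleting the first $d_{i-1} - d_{i-2}$ coordinates, so $\tau_i = \pi_i \circ \tau_{i-1}$. Define $Z^{(1)} \equiv 1$ on $\mathcal{D}_1$, recursively $Z^{(i)}(x) = \sum_{y \in \mathcal{D}_{i-1},\, \pi_i(y) = x} Z^{(i-1)}(y)^{\alpha_{i-1}}$ for $x \in \mathcal{D}_i$, $2 \le i \le s$, and $Z = \sum_{x \in \mathcal{D}_s} Z^{(s)}(x)^{\alpha_s}$. For a probability vector $q$ on $\mathcal{D}$, $\tau_i q$ is the push-forward probability vector on $\mathcal{D}_i$: $\tau_i q(y) = \sum_{x \in \mathcal{D},\, \tau_i(x) = y} q(x)$. A probability vector on a finite set $\mathcal{B}$ is uniform if all its entries equal $1/\#\mathcal{B}$. $\dim_{\mathrm H}$ is Hausdorff dimension and $\mathcal{H}^\gamma$ is the $\gamma$-dimensional Hausdorff measure. *)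

theory Defs
  imports "HOL-Analysis.Analysis"
begin

section \<open>Hausdorff measure and Hausdorff dimension\<close>

text \<open>
  The gauge is \<open>diam(U)\<^sup>\<gamma>\<close> with \<open>0\<^sup>0 = 1\<close> (whereas \<^term>\<open>(0::real) powr 0 = 0\<close>), and the empty
  set contributes \<open>0\<close>; thus the \<open>0\<close>-dimensional measure is counting measure. No normalising
  constant is used.
\<close>

definition hausdorff_gauge :: "real \<Rightarrow> 'a::metric_space set \<Rightarrow> ennreal" where
  "hausdorff_gauge \<gamma> U =
     (if U = {} then 0 else if \<gamma> = 0 then 1 else ennreal (diameter U powr \<gamma>))"

text \<open>
  Boundedness is required because \<^const>\<open>diameter\<close> is real-valued and unspecified on unbounded
  sets. Finite covers are included, as covering sets may be empty.
\<close>

definition hausdorff_premeasure :: "real \<Rightarrow> real \<Rightarrow> 'a::metric_space set \<Rightarrow> ennreal" where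
  "hausdorff_premeasure \<gamma> \<delta> S =
     (INF U \<in> {U :: nat \<Rightarrow> 'a set. S \<subseteq> (\<Union>k. U k) \<and> (\<forall>k. bounded (U k) \<and> diameter (U k) \<le> \<delta>)}.
        \<Sum>k. hausdorff_gauge \<gamma> (U k))"

definition hausdorff_measure :: "real \<Rightarrow> 'a::metric_space set \<Rightarrow> ennreal" where
  "hausdorff_measure \<gamma> S = (SUP \<delta> \<in> {0<..}. hausdorff_premeasure \<gamma> \<delta> S)"

text \<open>
  The infimum is taken in the reals, so this is meaningful for sets of finite Hausdorff dimension,
  in particular for all subsets of the torus below.
\<close>

definition hausdorff_dim :: "'a::metric_space set \<Rightarrow> real" where
  "hausdorff_dim S = Inf {\<gamma>. 0 \<le> \<gamma> \<and> hausdorff_measure \<gamma> S = 0}"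


section \<open>The torus\<close>

definition torus_rel :: "real^'d::finite \<Rightarrow> real^'d \<Rightarrow> bool" where
  "torus_rel x y \<longleftrightarrow> (\<forall>j. x $ j - y $ j \<in> \<int>)"

lemma torus_rel_refl: "torus_rel x x"
  by (simp add: torus_rel_def)

lemma torus_rel_sym: "torus_rel x y \<Longrightarrow> torus_rel y x"
  unfolding torus_rel_def by (metis Ints_minus minus_diff_eq)

lemma torus_rel_trans: "torus_rel x y \<Longrightarrow> torus_rel y z \<Longrightarrow> torus_rel x z"
  unfolding torus_rel_def by (metis Ints_add diff_add_cancel add_diff_eq)

quotient_type (overloaded) 'd torus = "real^'d::finite" / torus_rel
  by (intro equivpI reflpI sympI transpI)
     (auto intro: torus_rel_refl torus_rel_sym torus_rel_trans)

lift_definition torus_of :: "real^'d::finite \<Rightarrow> 'd torus" is "\<lambda>x. x" .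

lemma torus_of_eq_iff: "torus_of x = torus_of y \<longleftrightarrow> torus_rel x y"
  by transfer simp

lemma torus_of_surj: "\<exists>x. torus_of x = X"
  by transfer (use torus_rel_refl in blast)

lemma torus_of_infdist_eq:
  assumes "torus_of a = torus_of b"
  shows "infdist a {y. torus_of y = Y} \<le> infdist b {y. torus_of y = Y}"
proof -
  obtain y0 where y0: "torus_of y0 = Y" using torus_of_surj by blast
  have "infdist a {y. torus_of y = Y} \<le> dist b y" if y: "torus_of y = Y" for y
  proof -
    have r: "torus_rel a b" using assms by (simp add: torus_of_eq_iff)
    have "torus_rel (y + (a - b)) y"
      using r by (simp add: torus_rel_def)
    then have "torus_of (y + (a - b)) = Y" using y by (metis torus_of_eq_iff)
    then have "infdist a {y. torus_of y = Y} \<le> dist a (y + (a - b))"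
      by (intro infdist_le) auto
    also have "\<dots> = dist b y" by (simp add: dist_norm algebra_simps)
    finally show ?thesis .
  qed
  moreover have "{y. torus_of y = Y} \<noteq> {}" using y0 by blast
  ultimately show ?thesis
    by (auto simp: infdist_notempty intro!: cINF_greatest)
qed

lemma torus_of_setdist_infdist:
  assumes "torus_of a = X"
  shows "setdist {x. torus_of x = X} {y. torus_of y = Y} = infdist a {y. torus_of y = Y}"
proof -
  have ne: "{x. torus_of x = X} \<noteq> {}" using assms by blast
  have eq: "infdist x {y. torus_of y = Y} = infdist a {y. torus_of y = Y}" if "torus_of x = X" for x
    using torus_of_infdist_eq[of x a Y] torus_of_infdist_eq[of a x Y] assms that by fastforce
  have "setdist {x. torus_of x = X} {y. torus_of y = Y}
      = (INF x\<in>{x. torus_of x = X}. infdist x {y. torus_of y = Y})"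
    using ne unfolding setdist_eq_infdist by (simp only: if_False)
  also have "\<dots> = (INF x\<in>{x. torus_of x = X}. infdist a {y. torus_of y = Y})"
    by (rule INF_cong) (auto intro: eq)
  also have "\<dots> = infdist a {y. torus_of y = Y}" using ne by simp
  finally show ?thesis .
qed

text \<open>The quotient of the Euclidean metric: the distance of two cosets of \<open>\<int>\<^sup>d\<close> in \<open>\<real>\<^sup>d\<close>.\<close>

instantiation torus :: (finite) metric_space
begin

definition dist_torus :: "'a torus \<Rightarrow> 'a torus \<Rightarrow> real" where
  "dist_torus X Y = setdist {x. torus_of x = X} {y. torus_of y = Y}"

definition uniformity_torus :: "('a torus \<times> 'a torus) filter" where
  "uniformity_torus = (INF e\<in>{0<..}. principal {(X, Y). dist X Y < e})"

definition open_torus :: "'a torus set \<Rightarrow> bool" where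
  "open_torus U \<longleftrightarrow> (\<forall>X\<in>U. \<forall>\<^sub>F (X', Y) in uniformity. X' = X \<longrightarrow> Y \<in> U)"

instance
proof
  fix X Y Z :: "'a torus"
  obtain x where x: "torus_of x = X" using torus_of_surj by blast
  obtain y where y: "torus_of y = Y" using torus_of_surj by blast
  show "(dist X Y = 0) = (X = Y)"
  proof
    assume "dist X Y = 0"
    then have 0: "infdist x {y. torus_of y = Y} = 0"
      by (simp add: dist_torus_def torus_of_setdist_infdist[OF x])
    have "{u. torus_of u = Y} = (\<Inter>j. (\<lambda>u. u $ j - y $ j) -` \<int>)"
      using y by (auto simp: torus_of_eq_iff torus_rel_def)
    moreover have "closed ((\<lambda>u. u $ j - y $ j) -` (\<int> :: real set))" for j
      by (intro closed_vimage closed_Ints continuous_intros)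
    ultimately have "closed {u. torus_of u = Y}" by auto
    then have "x \<in> {u. torus_of u = Y}"
      using 0 y in_closed_iff_infdist_zero by blast
    then show "X = Y" using x by simp
  next
    assume "X = Y"
    then show "dist X Y = 0" by (simp add: dist_torus_def setdist_refl)
  qed
  show "dist X Y \<le> dist X Z + dist Y Z"
  proof -
    have *: "dist Y Z = dist Z Y" by (simp add: dist_torus_def setdist_sym)
    have "infdist x {u. torus_of u = Y} - dist Z Y \<le> dist x z" if z: "torus_of z = Z" for z
      using infdist_triangle[of x "{u. torus_of u = Y}" z]
      by (simp add: dist_torus_def torus_of_setdist_infdist[OF z])
    then have "infdist x {u. torus_of u = Y} - dist Z Y \<le> infdist x {u. torus_of u = Z}"
      using torus_of_surj[of Z] by (auto simp: infdist_notempty intro!: cINF_greatest)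
    then show ?thesis
      unfolding * by (simp add: dist_torus_def[of X] torus_of_setdist_infdist[OF x])
  qed
qed (simp_all only: uniformity_torus_def open_torus_def)

end


section \<open>Self-affine sponges\<close>

text \<open>
  The coordinates \<open>1, \<dots>, d\<close> are the elements of a finite linearly ordered type \<open>'d\<close> with \<open>d\<close>
  elements; \<open>position j\<close> is the number in \<open>{1, \<dots>, d}\<close> of the coordinate \<open>j\<close>.
\<close>

definition position :: "'d::{finite,linorder} \<Rightarrow> nat" where
  "position j = card {k. k \<le> j}"

definition digits :: "('d::{finite,linorder} \<Rightarrow> nat) \<Rightarrow> ('d \<Rightarrow> nat) set" where
  "digits m = {a. \<forall>j. a j < m j}"

text \<open>
  The map \<open>R\<close>. Digit sequences are indexed from \<open>0\<close>, so the \<open>k\<close>-th term (\<open>k \<ge> 1\<close>) of the series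
  \<open>\<Sum>\<^sub>k \<Lambda>\<^sup>-\<^sup>k x\<^sub>k\<close> appears here with index \<open>k - 1\<close>; \<open>\<Lambda>\<^sup>-\<^sup>k\<close> is diagonal with entries \<open>m\<^sub>j\<^sup>-\<^sup>k\<close>.
\<close>

definition sponge_map :: "('d::{finite,linorder} \<Rightarrow> nat) \<Rightarrow> (nat \<Rightarrow> 'd \<Rightarrow> nat) \<Rightarrow> 'd torus" where
  "sponge_map m x = torus_of (\<Sum>k. (\<chi> j. real (x k j) / real (m j) ^ Suc k))"

definition sponge :: "('d::{finite,linorder} \<Rightarrow> nat) \<Rightarrow> ('d \<Rightarrow> nat) set \<Rightarrow> 'd torus set" where
  "sponge m D = sponge_map m ` (UNIV \<rightarrow> D)"

text \<open>
  In the following, \<open>n\<close> and \<open>dd\<close> are the sequences \<open>n\<^sub>1 > \<dots> > n\<^sub>s\<close> of distinct values of \<open>m\<close> and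
  \<open>0 = d\<^sub>0 < \<dots> < d\<^sub>s = d\<close> of block ends. Level indices start at \<open>1\<close>.

  Deleting coordinates is modelled by \<^const>\<open>restrict\<close>, so the remaining coordinates keep their
  names. Hence \<open>\<tau>\<^sub>i\<close> (on \<open>D\<close>) and \<open>\<pi>\<^sub>i\<close> (on \<open>D\<^sub>i\<^sub>-\<^sub>1\<close>), which both leave exactly the coordinates
  \<open>d\<^sub>i\<^sub>-\<^sub>1 + 1, \<dots>, d\<close>, are given by the same function.
\<close>

definition level_proj :: "(nat \<Rightarrow> nat) \<Rightarrow> nat \<Rightarrow> ('d::{finite,linorder} \<Rightarrow> nat) \<Rightarrow> 'd \<Rightarrow> nat" where
  "level_proj dd i x = restrict x {j. dd (i - 1) < position j}"

definition level_digits ::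
    "(nat \<Rightarrow> nat) \<Rightarrow> ('d::{finite,linorder} \<Rightarrow> nat) set \<Rightarrow> nat \<Rightarrow> ('d \<Rightarrow> nat) set" where
  "level_digits dd D i = level_proj dd i ` D"

definition level_exp :: "(nat \<Rightarrow> nat) \<Rightarrow> nat \<Rightarrow> real" where
  "level_exp n i = (if i = 1 then 0 else ln (real (n i)) / ln (real (n (i - 1))))"

text \<open>The functions \<open>Z\<^sup>(\<^sup>i\<^sup>)\<close> for \<open>i \<ge> 1\<close>; the value for \<open>i = 0\<close> is a dummy.\<close>

fun Zfun :: "(nat \<Rightarrow> nat) \<Rightarrow> (nat \<Rightarrow> nat) \<Rightarrow> ('d::{finite,linorder} \<Rightarrow> nat) set \<Rightarrow> nat
    \<Rightarrow> ('d \<Rightarrow> nat) \<Rightarrow> real" where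
  "Zfun n dd D 0 x = 1"
| "Zfun n dd D (Suc 0) x = 1"
| "Zfun n dd D (Suc (Suc i)) x =
     (\<Sum>y\<in>{y \<in> level_digits dd D (Suc i). level_proj dd (Suc (Suc i)) y = x}.
        Zfun n dd D (Suc i) y powr level_exp n (Suc i))"

definition Ztotal ::
    "(nat \<Rightarrow> nat) \<Rightarrow> (nat \<Rightarrow> nat) \<Rightarrow> nat \<Rightarrow> ('d::{finite,linorder} \<Rightarrow> nat) set \<Rightarrow> real" where
  "Ztotal n dd s D = (\<Sum>x\<in>level_digits dd D s. Zfun n dd D s x powr level_exp n s)"

definition opt_vector :: "(nat \<Rightarrow> nat) \<Rightarrow> (nat \<Rightarrow> nat) \<Rightarrow> nat \<Rightarrow> ('d::{finite,linorder} \<Rightarrow> nat) set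
    \<Rightarrow> ('d \<Rightarrow> nat) \<Rightarrow> real" where
  "opt_vector n dd s D x =
     1 / Ztotal n dd s D
       * (\<Prod>i=1..s. Zfun n dd D i (level_proj dd i x) powr (level_exp n i - 1))"

definition level_push :: "(nat \<Rightarrow> nat) \<Rightarrow> ('d::{finite,linorder} \<Rightarrow> nat) set \<Rightarrow> nat
    \<Rightarrow> (('d \<Rightarrow> nat) \<Rightarrow> real) \<Rightarrow> ('d \<Rightarrow> nat) \<Rightarrow> real" where
  "level_push dd D i q y = (\<Sum>x\<in>{x \<in> D. level_proj dd i x = y}. q x)"

definition uniform_vector :: "'b set \<Rightarrow> ('b \<Rightarrow> real) \<Rightarrow> bool" where
  "uniform_vector B q \<longleftrightarrow> (\<forall>b\<in>B. q b = 1 / real (card B))"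

end

theory Submission
  imports Defs "HOL-Probability.Probability" "HOL-Real_Asymp.Real_Asymp"
begin

text \<open>
  Put \<open>h = ln Z\<close> and \<open>\<lambda>\<^sub>l = ln n\<^sub>s / ln n\<^sub>l\<close>, with \<open>\<lambda>\<^sub>0 = 0\<close>. At scale \<open>n\<^sub>s\<close> to the power \<open>- k\<close> a
  coordinate of block \<open>l\<close> is resolved by its first \<open>\<lambda>\<^sub>l k\<close> digits. So the digit vectors \<open>x\<^sub>t\<close> with
  \<open>\<lambda>\<^sub>l\<^sub>-\<^sub>1 k \<le> t < \<lambda>\<^sub>l k\<close> are seen through \<open>\<tau>\<^sub>l\<close> only, and the sequences that look the same form an
  approximate cube. If the digits are drawn independently with the probabilities \<open>p\<close>, the logarithm of
  its mass is the sum, over \<open>l\<close> and over these \<open>t\<close>, of \<open>ln (\<tau>\<^sub>l p (\<tau>\<^sub>l x\<^sub>t))\<close>. The vector \<open>p\<close> enters through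
  the identity \<open>\<Sum>\<^sub>l (\<lambda>\<^sub>l - \<lambda>\<^sub>l\<^sub>-\<^sub>1) ln (\<tau>\<^sub>l p (\<tau>\<^sub>l x)) = - h\<close>, valid for every single digit vector \<open>x\<close>
  (\<open>popt_balance\<close>). The argument is therefore carried out in an abstract setting, the locale
  \<open>level_system\<close>, and applied to the sponge at the end.
  
  The dimension is at most \<open>h / ln n\<^sub>s\<close>. Averaging over logarithmic scales shows that every sequence lies
  in approximate cubes of arbitrarily large scale \<open>k\<close> with mass at least \<open>exp (- k (h + \<epsilon>))\<close>
  (\<open>cube_mass_infinitely_often_large\<close>), and there are at most \<open>exp (k (h + \<epsilon>))\<close> such cubes; they form an
  economical cover (\<open>hausdorff_measure_eq_0\<close>).
  
  The measure in the critical dimension is infinite, following an idea of Peres for planar carpets.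
  The product measure with factors \<open>p\<close> is not good enough, because the cube masses fluctuate. Instead,
  at time \<open>t\<close> a mass \<open>\<epsilon>\<^sub>t \<approx> c / ln t\<close> is moved in \<open>p\<close> from a digit vector \<open>b\<close> to a digit vector \<open>a\<close>.
  Let \<open>A l\<close> be the difference of \<open>ln (\<tau>\<^sub>l p)\<close> between \<open>b\<close> and \<open>a\<close>. To first order, the entropy seen at
  scale \<open>k\<close> changes by the sum over \<open>l\<close> of \<open>A l\<close> times the total of the \<open>\<epsilon>\<^sub>t\<close> in the window of level \<open>l\<close>.
  If \<open>\<epsilon>\<^sub>t\<close> were constant this would vanish by the identity above; but the windows are located at
  different times, and the slow decay of \<open>\<epsilon>\<^sub>t\<close> leaves the term
  \<open>c k / (ln k)\<^sup>2 * \<Sum>\<^sub>l A l (\<theta>\<^sub>l - \<theta>\<^sub>l\<^sub>-\<^sub>1)\<close> with \<open>\<theta>\<^sub>l = - \<lambda>\<^sub>l ln \<lambda>\<^sub>l\<close> (\<open>gain_limit\<close>). The second order loss is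
  of size \<open>c\<^sup>2 k / (ln k)\<^sup>2\<close>, hence smaller for small \<open>c\<close>, and random fluctuations are of the much smaller
  order \<open>\<surd>k\<close>. So almost every sequence has all its cubes of large scale lighter than \<open>exp (- k h)\<close> by a
  factor \<open>exp (- \<eta> k / (ln k)\<^sup>2)\<close> (\<open>light_cubes_measure\<close>), and comparing coverings with this measure
  gives infinite Hausdorff measure (\<open>hausdorff_measure_eq_top\<close>).
  
  It remains to choose \<open>a\<close> and \<open>b\<close> with \<open>\<Sum>\<^sub>l A l (\<theta>\<^sub>l - \<theta>\<^sub>l\<^sub>-\<^sub>1) > 0\<close>. The sequence \<open>A\<close> is supported on
  the levels where \<open>\<tau>\<^sub>l p\<close> is not uniform and satisfies \<open>\<Sum>\<^sub>l (\<lambda>\<^sub>l - \<lambda>\<^sub>l\<^sub>-\<^sub>1) A l = 0\<close>. If there are at most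
  two such levels, strict concavity of \<open>- \<lambda> ln \<lambda>\<close> makes the two linear forms independent on this
  support, so a nonzero \<open>A\<close> has a nonzero gain, and exchanging \<open>a\<close> and \<open>b\<close> fixes the sign
  (\<open>positive_gain_exists\<close>).
\<close>

section \<open>Averages of shifted functions\<close>

lemma integrable_on_Icc_bounded:
  fixes f :: "real \<Rightarrow> real"
  assumes "f \<in> borel_measurable borel" "\<And>v. \<bar>f v\<bar> \<le> B"
  shows "f integrable_on {a..b}"
proof (rule measurable_bounded_by_integrable_imp_integrable_real[where g="\<lambda>_. B"])
  show "f \<in> borel_measurable (lebesgue_on {a..b})"
    using assms(1) by (simp add: measurable_completion measurable_restrict_space1)
qed (use assms(2) in auto)

lemma abs_integral_Icc_le:
  fixes f :: "real \<Rightarrow> real"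
  assumes "f \<in> borel_measurable borel" "\<And>v. \<bar>f v\<bar> \<le> B" "a \<le> b"
  shows "\<bar>integral {a..b} f\<bar> \<le> B * (b - a)"
proof -
  have "norm (integral {a..b} f) \<le> integral {a..b} (\<lambda>_. B)"
    by (rule integral_norm_bound_integral)
       (use assms integrable_on_Icc_bounded[OF assms(1,2)] in auto)
  then show ?thesis using assms(3) by (simp add: mult.commute)
qed

text \<open>
  The two integrals run over \<open>{a - c..b - c}\<close> and \<open>{a..b}\<close>, which differ by two intervals of length
  \<open>c\<close>. The point is that the bound does not depend on \<open>b - a\<close>: on long intervals a shift is
  invisible in the average.
\<close>

lemma integral_shift_diff_le:
  fixes f :: "real \<Rightarrow> real"
  assumes meas: "f \<in> borel_measurable borel" and bnd: "\<And>v. \<bar>f v\<bar> \<le> B"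
    and ab: "a \<le> b" and c: "0 \<le> c"
  shows "\<bar>integral {a..b} (\<lambda>v. f (v - c)) - integral {a..b} f\<bar> \<le> 2 * B * c"
proof -
  note int = integrable_on_Icc_bounded[OF meas bnd]
  note le = abs_integral_Icc_le[OF meas bnd]
  have "(f has_integral integral {a - c..b - c} f) {a + - c..b + - c}"
    using int by (simp add: integrable_integral)
  then have "((\<lambda>v. f (v + - c)) has_integral integral {a - c..b - c} f) {a..b}"
    unfolding has_integral_shift_Icc_real[symmetric] by (simp add: o_def)
  then have 1: "integral {a..b} (\<lambda>v. f (v - c)) = integral {a - c..b - c} f"
    by (simp add: integral_unique)
  have "integral {a - c..b - c} f + integral {b - c..b} f = integral {a - c..b} f"
    "integral {a - c..a} f + integral {a..b} f = integral {a - c..b} f"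
    by (rule Henstock_Kurzweil_Integration.integral_combine; use ab c int in auto)+
  with le[of "b - c" b] le[of "a - c" a] c 1 show ?thesis by (simp add: field_simps)
qed

section \<open>Level systems and the masses of approximate cubes\<close>

text \<open>
  The mass at \<open>f x\<close> of the image of \<open>q\<close> under \<open>f\<close>. Indexing by \<open>x \<in> D\<close> rather than by the image
  point lets all levels be treated on the same set \<open>D\<close>.
\<close>

definition fibre_mass :: "'a set \<Rightarrow> ('a \<Rightarrow> 'b) \<Rightarrow> ('a \<Rightarrow> real) \<Rightarrow> 'a \<Rightarrow> real" where
  "fibre_mass D f q x = (\<Sum>z\<in>{z \<in> D. f z = f x}. q z)"

text \<open>
  The symbolic content of a self-affine sponge. At scale \<open>k\<close> the digits with index \<open>t\<close> between
  \<open>\<lambda>\<^sub>l\<^sub>-\<^sub>1 k\<close> and \<open>\<lambda>\<^sub>l k\<close> are seen only through \<open>\<tau>\<^sub>l\<close>. The assumption \<open>balance\<close> says that,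
  for each single digit, the logarithmic fibre masses averaged over the levels with the weights
  \<open>\<lambda>\<^sub>l - \<lambda>\<^sub>l\<^sub>-\<^sub>1\<close> give the same value \<open>- h\<close>. For a sponge it holds for the weights \<open>p\<close>, and \<open>h\<close> is the
  dimension times the logarithm of the smallest base.
\<close>

locale level_system =
  fixes D :: "'a set" and tau :: "nat \<Rightarrow> 'a \<Rightarrow> 'b" and s :: nat
    and lam :: "nat \<Rightarrow> real" and P :: "'a \<Rightarrow> real" and h :: real
  assumes finite_D: "finite D"
    and s_ge_1: "1 \<le> s"
    and lam_0: "lam 0 = 0" and lam_s: "lam s = 1"
    and lam_less: "\<And>l. l \<in> {1..s} \<Longrightarrow> lam (l - 1) < lam l"
    and P_pos: "\<And>x. x \<in> D \<Longrightarrow> 0 < P x" and P_sum: "sum P D = 1"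
    and balance: "\<And>x. x \<in> D \<Longrightarrow>
      (\<Sum>l=1..s. (lam l - lam (l - 1)) * ln (fibre_mass D (tau l) P x)) = - h"
begin

abbreviation "pm l x \<equiv> fibre_mass D (tau l) P x"

definition cut :: "nat \<Rightarrow> nat \<Rightarrow> nat" where
  "cut l k = nat \<lfloor>lam l * real k\<rfloor>"

text \<open>
  The level through which digit \<open>t\<close> is seen at scale \<open>k\<close>; it is meaningful for \<open>t < k\<close>.
\<close>

definition lev :: "nat \<Rightarrow> nat \<Rightarrow> nat" where
  "lev k t = (LEAST l. t < cut l k)"

text \<open>
  The code of the approximate cube of scale \<open>k\<close> around \<open>x\<close>: two sequences lie in the same cube iff
  their words agree.
\<close>

definition cube_word :: "nat \<Rightarrow> (nat \<Rightarrow> 'a) \<Rightarrow> nat \<Rightarrow> 'b" where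
  "cube_word k x = (\<lambda>t\<in>{..<k}. tau (lev k t) (x t))"

lemma D_nonempty: "D \<noteq> {}" using P_sum by auto

lemma lam_mono: "i \<le> j \<Longrightarrow> j \<le> s \<Longrightarrow> lam i \<le> lam j"
proof (induction j)
  case (Suc j)
  then show ?case using lam_less[of "Suc j"] by (cases "i = Suc j") auto
qed simp

lemma lam_nonneg: "l \<le> s \<Longrightarrow> 0 \<le> lam l" and lam_le_1: "l \<le> s \<Longrightarrow> lam l \<le> 1"
  using lam_mono[of 0 l] lam_mono[of l s] lam_0 lam_s by auto

lemma lam_pos: "l \<in> {1..s} \<Longrightarrow> 0 < lam l"
  using lam_less[of l] lam_nonneg[of "l - 1"] by force

lemma cut_0 [simp]: "cut 0 k = 0" by (simp add: cut_def lam_0)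

lemma cut_s [simp]: "cut s k = k" by (simp add: cut_def lam_s)

lemma cut_mono: "i \<le> j \<Longrightarrow> j \<le> s \<Longrightarrow> cut i k \<le> cut j k"
  unfolding cut_def using lam_mono by (intro nat_mono floor_mono mult_right_mono) auto

lemma cut_le: "l \<le> s \<Longrightarrow> real (cut l k) \<le> lam l * real k"
  using lam_nonneg[of l] by (simp add: cut_def)

lemma cut_gt: "l \<le> s \<Longrightarrow> lam l * real k - 1 < real (cut l k)"
  unfolding cut_def using lam_nonneg[of l] by linarith

lemma lev_eq:
  assumes "l \<in> {1..s}" "cut (l - 1) k \<le> t" "t < cut l k"
  shows "lev k t = l"
  unfolding lev_def
proof (rule Least_equality)
  fix l' assume *: "t < cut l' k"
  show "l \<le> l'"
  proof (rule ccontr)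
    assume "\<not> l \<le> l'"
    then have "cut l' k \<le> cut (l - 1) k" using assms(1) by (intro cut_mono) auto
    with * assms(2) show False by simp
  qed
qed (use assms in auto)

lemma lev_props:
  assumes "t < k"
  shows "lev k t \<in> {1..s}" "cut (lev k t - 1) k \<le> t" "t < cut (lev k t) k"
proof -
  have 1: "t < cut s k" using assms by simp
  show 2: "t < cut (lev k t) k" unfolding lev_def by (rule LeastI[of "\<lambda>l. t < cut l k", OF 1])
  have 3: "lev k t \<le> s" unfolding lev_def by (rule Least_le[of "\<lambda>l. t < cut l k", OF 1])
  moreover have "lev k t \<noteq> 0" using 2 by (metis cut_0 not_less_zero)
  ultimately show "lev k t \<in> {1..s}" by auto
  show "cut (lev k t - 1) k \<le> t"
    using not_less_Least[of "lev k t - 1" "\<lambda>l. t < cut l k"] \<open>lev k t \<noteq> 0\<close>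
    by (simp add: lev_def[symmetric] not_less)
qed

text \<open>
  Writing the sum over the window of level \<open>l\<close> as a difference of two initial sums is what makes the
  later estimates work: an initial sum up to \<open>\<lambda>\<^sub>l k\<close> is an initial sum of the same kind at another
  scale.
\<close>

lemma sum_lev:
  fixes f :: "nat \<Rightarrow> nat \<Rightarrow> real"
  shows "(\<Sum>t<k. f (lev k t) t) = (\<Sum>l=1..s. (\<Sum>t<cut l k. f l t) - (\<Sum>t<cut (l - 1) k. f l t))"
proof -
  have "(\<Sum>t<cut r k. f (lev k t) t) = (\<Sum>l=1..r. (\<Sum>t<cut l k. f l t) - (\<Sum>t<cut (l - 1) k. f l t))"
    if "r \<le> s" for r using that
  proof (induction r)
    case (Suc r)
    have split: "{..<cut (Suc r) k} = {..<cut r k} \<union> {cut r k..<cut (Suc r) k}"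
      using cut_mono[of r "Suc r" k] Suc.prems by auto
    have "(\<Sum>t<cut (Suc r) k. g t) = (\<Sum>t<cut r k. g t) + (\<Sum>t\<in>{cut r k..<cut (Suc r) k}. g t)"
      for g :: "nat \<Rightarrow> real" unfolding split by (rule sum.union_disjoint) auto
    moreover have "(\<Sum>t\<in>{cut r k..<cut (Suc r) k}. f (lev k t) t)
        = (\<Sum>t\<in>{cut r k..<cut (Suc r) k}. f (Suc r) t)"
      using Suc.prems by (intro sum.cong refl arg_cong2[where f=f] lev_eq) auto
    ultimately show ?case using Suc by simp
  qed simp
  from this[of s] show ?thesis by simp
qed

lemma pm_ge_P: "x \<in> D \<Longrightarrow> P x \<le> pm l x"
  unfolding fibre_mass_def using finite_D P_pos
  by (intro member_le_sum) (auto intro: less_imp_le)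

lemma pm_pos: "x \<in> D \<Longrightarrow> 0 < pm l x"
  using pm_ge_P[of x l] P_pos[of x] by simp

lemma pm_le_1: "x \<in> D \<Longrightarrow> pm l x \<le> 1"
  unfolding fibre_mass_def P_sum[symmetric] using finite_D P_pos
  by (intro sum_mono2) (auto intro: less_imp_le)

lemma h_nonneg: "0 \<le> h"
proof -
  obtain x where x: "x \<in> D" using D_nonempty by auto
  have "(\<Sum>l=1..s. (lam l - lam (l - 1)) * ln (pm l x)) \<le> 0"
    using lam_less pm_pos[OF x] pm_le_1[OF x]
    by (intro sum_nonpos mult_nonneg_nonpos) (auto intro: less_imp_le)
  with balance[OF x] show ?thesis by simp
qed

lemma ln_pm_bound: "\<exists>B>0. \<forall>l. \<forall>x\<in>D. - B \<le> ln (pm l x) \<and> ln (pm l x) \<le> 0"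
proof -
  define B where "B = 1 - ln (Min (P ` D))"
  have min: "0 < Min (P ` D)" using finite_D D_nonempty P_pos by auto
  have le: "Min (P ` D) \<le> pm l x" if "x \<in> D" for x l
    using that pm_ge_P[of x l] finite_D by (meson Min_le finite_imageI imageI order_trans)
  have "- B \<le> ln (pm l x)" "ln (pm l x) \<le> 0" if "x \<in> D" for x l
    using le[OF that, of l] min pm_pos[OF that, of l] pm_le_1[OF that, of l]
    by (auto simp: B_def intro: order_trans[of _ "ln (Min (P ` D))"])
  moreover have "Min (P ` D) \<le> 1"
    using D_nonempty le pm_le_1 by (meson all_not_in_conv order_trans)
  then have "ln (Min (P ` D)) \<le> 0" using min by simp
  then have "0 < B" by (simp add: B_def)
  ultimately show ?thesis by blast
qed

text \<open>
  Along any sequence of digits, the mass of the approximate cube is infinitely often at least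
  \<open>exp (- k (h + \<epsilon>))\<close>. Let \<open>\<psi>\<^sub>l\<close> be the average of \<open>ln (pm l x\<^sub>t)\<close> over the first \<open>exp v\<close> digits, as
  a function of the logarithmic scale \<open>v\<close>. Up to rounding, the logarithm of the mass divided by
  \<open>exp v\<close> is \<open>\<Sum>\<^sub>l \<lambda>\<^sub>l \<psi>\<^sub>l (v + ln \<lambda>\<^sub>l) - \<lambda>\<^sub>l\<^sub>-\<^sub>1 \<psi>\<^sub>l (v + ln \<lambda>\<^sub>l\<^sub>-\<^sub>1)\<close>. In the average over a long
  range of \<open>v\<close> the shifts do not matter, and without them the sum is \<open>- h\<close> by the balance
  assumption. So this function cannot stay below \<open>- h - \<epsilon>\<close>.
\<close>

lemma cube_mass_infinitely_often_large:
  assumes x: "x \<in> UNIV \<rightarrow> D" and eps: "0 < \<epsilon>"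
  shows "\<exists>k\<ge>k0. - real k * (h + \<epsilon>) \<le> (\<Sum>t<k. ln (pm (lev k t) (x t)))"
proof -
  obtain B where B: "0 < B" "\<And>l x. x \<in> D \<Longrightarrow> \<bar>ln (pm l x)\<bar> \<le> B"
    using ln_pm_bound by (metis abs_le_iff abs_of_nonpos minus_le_iff)
  define G where "G l n = (\<Sum>t<n. ln (pm l (x t)))" for l n
  define \<psi> where "\<psi> l v = G l (nat \<lfloor>exp v\<rfloor>) / exp v" for l v
  have Gdiff: "\<bar>G l m - G l n\<bar> \<le> B * \<bar>real m - real n\<bar>" for l m n
  proof -
    have *: "\<bar>G l m - G l n\<bar> \<le> B * \<bar>real m - real n\<bar>" if "n \<le> m" for m n
    proof -
      have "{..<m} = {..<n} \<union> {n..<m}" using that by auto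
      then have "G l m = G l n + (\<Sum>t\<in>{n..<m}. ln (pm l (x t)))"
        unfolding G_def by (simp add: sum.union_disjoint ivl_disj_int)
      moreover have "\<bar>\<Sum>t\<in>{n..<m}. ln (pm l (x t))\<bar> \<le> (\<Sum>t\<in>{n..<m}. B)"
        using B x by (intro order_trans[OF sum_abs] sum_mono) auto
      ultimately show ?thesis using that by (simp add: of_nat_diff mult.commute)
    qed
    show ?thesis using *[of n m] *[of m n] by (cases "n \<le> m") (auto simp: abs_minus_commute)
  qed
  have fl: "real (nat \<lfloor>exp v\<rfloor>) \<le> exp v" "exp v - 1 < real (nat \<lfloor>exp v\<rfloor>)" for v :: real
  proof -
    have "0 \<le> exp v" by simp
    then show "real (nat \<lfloor>exp v\<rfloor>) \<le> exp v" "exp v - 1 < real (nat \<lfloor>exp v\<rfloor>)" by linarith+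
  qed
  have psi_bnd: "\<bar>\<psi> l v\<bar> \<le> B" for l v
  proof -
    have "\<bar>G l (nat \<lfloor>exp v\<rfloor>)\<bar> \<le> B * real (nat \<lfloor>exp v\<rfloor>)"
      using Gdiff[of l "nat \<lfloor>exp v\<rfloor>" 0] by (simp add: G_def)
    also have "\<dots> \<le> B * exp v" using B fl by (intro mult_left_mono) auto
    finally show ?thesis by (simp add: \<psi>_def divide_simps)
  qed
  have psi_meas: "\<psi> l \<in> borel_measurable borel" for l
    unfolding \<psi>_def by measurable
  define F where "F k = (\<Sum>t<k. ln (pm (lev k t) (x t)))" for k
  have F_eq: "F k = (\<Sum>l=1..s. G l (cut l k) - G l (cut (l - 1) k))" for k
    unfolding F_def G_def by (rule sum_lev)
  \<comment> \<open>The shifts are written as subtractions of nonnegative numbers. For \<open>j = 0\<close> the value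
    \<open>ln 0 = 0\<close> is harmless, as the coefficient \<open>lam 0\<close> vanishes.\<close>
  define \<Phi> where "\<Phi> v = (\<Sum>l=1..s. lam l * \<psi> l (v - - ln (lam l))
      - lam (l - 1) * \<psi> l (v - - ln (lam (l - 1))))" for v
  have rounding: "\<bar>lam j * \<psi> l (v - - ln (lam j)) * exp v - G l (cut j (nat \<lfloor>exp v\<rfloor>))\<bar> \<le> 2 * B"
    if "j \<le> s" for j l v
  proof (cases "j = 0")
    case True
    then show ?thesis using B by (simp add: lam_0 G_def)
  next
    case False
    with that have lp: "0 < lam j" by (intro lam_pos) auto
    have "lam j * \<psi> l (v - - ln (lam j)) * exp v = G l (nat \<lfloor>lam j * exp v\<rfloor>)"
      using lp by (simp add: \<psi>_def exp_add mult.commute)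
    moreover have "\<bar>real (nat \<lfloor>lam j * exp v\<rfloor>) - real (cut j (nat \<lfloor>exp v\<rfloor>))\<bar> \<le> 2"
    proof -
      let ?m = "real (nat \<lfloor>exp v\<rfloor>)"
      have "lam j * ?m \<le> lam j * exp v" "lam j * exp v \<le> lam j * ?m + lam j * 1"
        using mult_left_mono[of ?m "exp v" "lam j"] mult_left_mono[of "exp v" "?m + 1" "lam j"] lp fl[of v]
        by (auto simp: distrib_left)
      moreover have "0 \<le> lam j * exp v" using lp by simp
      ultimately show ?thesis
        using cut_le[OF that, of "nat \<lfloor>exp v\<rfloor>"] cut_gt[OF that, of "nat \<lfloor>exp v\<rfloor>"] lam_le_1[OF that]
        by linarith
    qed
    ultimately show ?thesis
      using order_trans[OF Gdiff mult_left_mono[of _ 2 B]] B by (simp add: mult.commute)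
  qed
  have F_ge: "\<Phi> v * exp v - 4 * B * real s \<le> F (nat \<lfloor>exp v\<rfloor>)" for v
  proof -
    have "\<Phi> v * exp v - F (nat \<lfloor>exp v\<rfloor>) =
       (\<Sum>l=1..s. (lam l * \<psi> l (v - - ln (lam l)) * exp v - G l (cut l (nat \<lfloor>exp v\<rfloor>)))
        - (lam (l - 1) * \<psi> l (v - - ln (lam (l - 1))) * exp v - G l (cut (l - 1) (nat \<lfloor>exp v\<rfloor>))))"
      unfolding \<Phi>_def F_eq sum_distrib_right sum_subtractf[symmetric]
      by (intro sum.cong refl) (simp add: algebra_simps)
    also have "\<dots> \<le> (\<Sum>l=1..s. 4 * B)"
    proof (rule sum_mono)
      fix l assume "l \<in> {1..s}"
      then have "l \<le> s" "l - 1 \<le> s" by auto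
      from rounding[OF this(1), of l v] rounding[OF this(2), of l v]
      show "(lam l * \<psi> l (v - - ln (lam l)) * exp v - G l (cut l (nat \<lfloor>exp v\<rfloor>)))
        - (lam (l - 1) * \<psi> l (v - - ln (lam (l - 1))) * exp v - G l (cut (l - 1) (nat \<lfloor>exp v\<rfloor>))) \<le> 4 * B"
        by linarith
    qed
    finally show ?thesis by (simp add: mult.commute)
  qed
  have avg: "- h \<le> (\<Sum>l=1..s. (lam l - lam (l - 1)) * \<psi> l v)" for v
  proof -
    have "(\<Sum>l=1..s. (lam l - lam (l - 1)) * G l n) = - h * real n" for n
    proof -
      have "(\<Sum>l=1..s. (lam l - lam (l - 1)) * G l n)
          = (\<Sum>t<n. \<Sum>l=1..s. (lam l - lam (l - 1)) * ln (pm l (x t)))"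
        unfolding G_def sum_distrib_left by (rule sum.swap)
      also have "\<dots> = (\<Sum>t<n. - h)" using x by (intro sum.cong refl balance) auto
      finally show ?thesis by simp
    qed
    then have "(\<Sum>l=1..s. (lam l - lam (l - 1)) * \<psi> l v) = - h * real (nat \<lfloor>exp v\<rfloor>) / exp v"
      unfolding \<psi>_def times_divide_eq_right sum_divide_distrib[symmetric] by simp
    moreover have "h * real (nat \<lfloor>exp v\<rfloor>) \<le> h * exp v"
      using h_nonneg fl by (intro mult_left_mono)
    then have "h * real (nat \<lfloor>exp v\<rfloor>) / exp v \<le> h" by (simp only: pos_divide_le_eq exp_gt_zero)
    ultimately show ?thesis by linarith
  qed
  define C where "C = (\<Sum>l=1..s. lam l * (2 * B * - ln (lam l)) + lam (l - 1) * (2 * B * - ln (lam (l - 1))))"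
  have shift: "\<bar>lam j * integral {a..b} (\<lambda>v. \<psi> l (v - - ln (lam j))) - lam j * integral {a..b} (\<psi> l)\<bar>
      \<le> lam j * (2 * B * - ln (lam j))" if "j \<le> s" "a \<le> b" for j l a b
  proof (cases "j = 0")
    case False
    with that have lp: "0 < lam j" by (intro lam_pos) auto
    have "\<bar>integral {a..b} (\<lambda>v. \<psi> l (v - - ln (lam j))) - integral {a..b} (\<psi> l)\<bar> \<le> 2 * B * - ln (lam j)"
      using lp lam_le_1[OF that(1)] that(2) psi_meas psi_bnd by (intro integral_shift_diff_le) auto
    then show ?thesis using lp
      by (simp only: right_diff_distrib[symmetric] abs_mult abs_of_pos mult_le_cancel_left_pos)
  qed (simp add: lam_0)
  have int: "\<psi> l integrable_on {a..b}" "(\<lambda>v. \<psi> l (v - c)) integrable_on {a..b}" for l a b c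
    using psi_meas[of l] psi_bnd by (auto intro!: integrable_on_Icc_bounded[where B=B])
  have int_ge: "- h * (b - a) - C \<le> integral {a..b} \<Phi>" if "a \<le> b" for a b
  proof -
    have "- h * (b - a) = integral {a..b} (\<lambda>_. - h)" using that by simp
    also have "\<dots> \<le> integral {a..b} (\<lambda>v. \<Sum>l=1..s. (lam l - lam (l - 1)) * \<psi> l v)"
      using avg int by (intro integral_le integrable_sum integrable_on_mult_right) auto
    also have "\<dots> = (\<Sum>l=1..s. (lam l - lam (l - 1)) * integral {a..b} (\<psi> l))"
      using int by (subst integral_sum) (auto intro!: integrable_on_mult_right)
    also have "\<dots> \<le> (\<Sum>l=1..s. (lam l * integral {a..b} (\<lambda>v. \<psi> l (v - - ln (lam l)))
        - lam (l - 1) * integral {a..b} (\<lambda>v. \<psi> l (v - - ln (lam (l - 1)))))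
        + (lam l * (2 * B * - ln (lam l)) + lam (l - 1) * (2 * B * - ln (lam (l - 1)))))"
    proof (rule sum_mono)
      fix l assume "l \<in> {1..s}"
      then have "l \<le> s" "l - 1 \<le> s" by auto
      from shift[OF this(1) \<open>a \<le> b\<close>, of l] shift[OF this(2) \<open>a \<le> b\<close>, of l]
      show "(lam l - lam (l - 1)) * integral {a..b} (\<psi> l) \<le>
        (lam l * integral {a..b} (\<lambda>v. \<psi> l (v - - ln (lam l)))
        - lam (l - 1) * integral {a..b} (\<lambda>v. \<psi> l (v - - ln (lam (l - 1)))))
        + (lam l * (2 * B * - ln (lam l)) + lam (l - 1) * (2 * B * - ln (lam (l - 1))))"
        unfolding left_diff_distrib by linarith
    qed
    also have "\<dots> = integral {a..b} \<Phi> + C"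
    proof -
      have "integral {a..b} \<Phi> = (\<Sum>l=1..s. integral {a..b} (\<lambda>v. lam l * \<psi> l (v - - ln (lam l))
          - lam (l - 1) * \<psi> l (v - - ln (lam (l - 1)))))"
        unfolding \<Phi>_def by (intro integral_sum integrable_diff integrable_on_mult_right int) auto
      also have "\<dots> = (\<Sum>l=1..s. lam l * integral {a..b} (\<lambda>v. \<psi> l (v - - ln (lam l)))
          - lam (l - 1) * integral {a..b} (\<lambda>v. \<psi> l (v - - ln (lam (l - 1)))))"
        by (simp only: integral_diff[OF integrable_on_mult_right[OF int(2)] integrable_on_mult_right[OF int(2)]]
            integral_mult_right)
      finally show ?thesis unfolding C_def sum.distrib by simp
    qed
    finally show ?thesis by simp
  qed
  have Phi_int: "\<Phi> integrable_on {a..b}" for a b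
    unfolding \<Phi>_def by (intro integrable_sum integrable_diff integrable_on_mult_right int) auto
  have ex: "\<exists>v\<ge>V. - (h + \<epsilon> / 2) \<le> \<Phi> v" for V
  proof (rule ccontr)
    assume "\<not> ?thesis"
    then have *: "\<Phi> v \<le> - (h + \<epsilon> / 2)" if "V \<le> v" for v using that by force
    define W where "W = V + (2 * \<bar>C\<bar> + 1) / \<epsilon>"
    have VW: "V \<le> W" using eps by (simp add: W_def)
    have "- h * (W - V) - C \<le> integral {V..W} (\<lambda>_. - (h + \<epsilon> / 2))"
      using int_ge[OF VW] integral_le[OF Phi_int[of V W], of "\<lambda>_. - (h + \<epsilon> / 2)"] *
      by fastforce
    then have "\<epsilon> / 2 * (W - V) \<le> C" using VW by (simp add: algebra_simps)
    moreover have "\<epsilon> / 2 * (W - V) = \<bar>C\<bar> + 1 / 2" using eps by (simp add: W_def field_simps)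
    ultimately show False by linarith
  qed
  have "\<forall>\<^sub>F v in at_top. real k0 + 1 \<le> exp v" by real_asymp
  moreover have "\<forall>\<^sub>F v in at_top. 4 * B * real s + h + \<epsilon> / 2 \<le> (exp v - 1) * (\<epsilon> / 2)"
    using eps by real_asymp
  ultimately have "\<forall>\<^sub>F v in at_top. real k0 + 1 \<le> exp v \<and>
      4 * B * real s + h + \<epsilon> / 2 \<le> (exp v - 1) * (\<epsilon> / 2)" by eventually_elim auto
  then obtain V where V: "\<And>v. V \<le> v \<Longrightarrow> real k0 + 1 \<le> exp v \<and>
      4 * B * real s + h + \<epsilon> / 2 \<le> (exp v - 1) * (\<epsilon> / 2)"
    by (auto simp: eventually_at_top_linorder)
  obtain v where v: "V \<le> v" "- (h + \<epsilon> / 2) \<le> \<Phi> v" using ex by blast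
  let ?k = "nat \<lfloor>exp v\<rfloor>"
  have "k0 \<le> ?k" using V[OF v(1)] by linarith
  moreover have "- real ?k * (h + \<epsilon>) \<le> F ?k"
  proof -
    have "- (h + \<epsilon> / 2) * exp v \<le> \<Phi> v * exp v" using v(2) by (intro mult_right_mono) auto
    moreover have "(h + \<epsilon> / 2) * exp v \<le> (h + \<epsilon> / 2) * (real ?k + 1)"
      using fl(2)[of v] h_nonneg eps by (intro mult_left_mono) auto
    moreover have "(exp v - 1) * (\<epsilon> / 2) \<le> real ?k * (\<epsilon> / 2)"
      using fl(2)[of v] eps by (intro mult_right_mono) auto
    ultimately show ?thesis using F_ge[of v] V[OF v(1)] by (simp add: algebra_simps)
  qed
  ultimately show ?thesis unfolding F_def by blast
qed

text \<open>
  The masses of the approximate cubes of scale \<open>k\<close> add up to \<open>1\<close>, so at most \<open>exp c\<close> of them have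
  mass at least \<open>exp (- c)\<close>.
\<close>

lemma card_heavy_words:
  "finite (cube_word k ` {x \<in> UNIV \<rightarrow> D. - c \<le> (\<Sum>t<k. ln (pm (lev k t) (x t)))})" (is "finite ?W")
  "real (card (cube_word k ` {x \<in> UNIV \<rightarrow> D. - c \<le> (\<Sum>t<k. ln (pm (lev k t) (x t)))})) \<le> exp c"
proof -
  let ?A = "\<lambda>t. tau (lev k t) ` D"
  define w where "w t y = (\<Sum>z\<in>{z \<in> D. tau (lev k t) z = y}. P z)" for t y
  have w0: "0 \<le> w t y" for t y unfolding w_def using P_pos by (intro sum_nonneg) (auto intro: less_imp_le)
  have fin: "finite (PiE {..<k} ?A)" using finite_D by (intro finite_PiE) auto
  have sub: "?W \<subseteq> PiE {..<k} ?A" by (auto simp: cube_word_def PiE_def Pi_iff)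
  show "finite ?W" by (rule finite_subset[OF sub fin])
  have "(\<Sum>y\<in>?A t. w t y) = 1" for t
    unfolding w_def P_sum[symmetric] by (rule sum.group) (use finite_D in auto)
  then have "1 = (\<Prod>t<k. \<Sum>y\<in>?A t. w t y)" by simp
  also have "\<dots> = (\<Sum>g\<in>PiE {..<k} ?A. \<Prod>t<k. w t (g t))"
    using finite_D by (intro prod_sum_PiE) auto
  also have "\<dots> \<ge> (\<Sum>g\<in>?W. \<Prod>t<k. w t (g t))"
    using fin sub w0 by (intro sum_mono2) (auto intro: prod_nonneg)
  moreover have "(\<Sum>g\<in>?W. exp (- c)) \<le> (\<Sum>g\<in>?W. \<Prod>t<k. w t (g t))"
  proof (rule sum_mono)
    fix g assume "g \<in> ?W"
    then obtain x where x: "x \<in> UNIV \<rightarrow> D" "- c \<le> (\<Sum>t<k. ln (pm (lev k t) (x t)))" and g: "g = cube_word k x"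
      by auto
    have "exp (- c) \<le> exp (\<Sum>t<k. ln (pm (lev k t) (x t)))" using x by simp
    also have "\<dots> = (\<Prod>t<k. pm (lev k t) (x t))"
      unfolding exp_sum[OF finite_lessThan] using x(1)
      by (intro prod.cong refl exp_ln pm_pos) auto
    also have "\<dots> = (\<Prod>t<k. w t (g t))"
      by (intro prod.cong refl) (simp add: g cube_word_def w_def fibre_mass_def)
    finally show "exp (- c) \<le> (\<Prod>t<k. w t (g t))" .
  qed
  ultimately have "real (card ?W) * exp (- c) \<le> 1" by simp
  then show "real (card ?W) \<le> exp c" by (simp add: exp_minus field_simps)
qed

end

section \<open>Entropy gained by a slowly decaying perturbation\<close>

lemma fibre_mass_shift:
  assumes "finite D" "a \<in> D" "b \<in> D"
  shows "fibre_mass D f (\<lambda>x. P x + \<epsilon> * (of_bool (x = a) - of_bool (x = b))) x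
    = fibre_mass D f P x + \<epsilon> * (of_bool (f a = f x) - of_bool (f b = f x))"
proof -
  have "(\<Sum>z\<in>{z \<in> D. f z = f x}. of_bool (z = c)) = (of_bool (f c = f x) :: real)" if "c \<in> D" for c
  proof -
    have "(\<Sum>z\<in>{z \<in> D. f z = f x}. of_bool (z = c))
        = (\<Sum>z\<in>{z \<in> D. f z = f x}. if z = c then 1 else 0 :: real)"
      by (intro sum.cong) auto
    also have "\<dots> = of_bool (f c = f x)"
      using assms(1) that by (subst sum.delta) auto
    finally show ?thesis .
  qed
  then show ?thesis using assms
    by (simp add: fibre_mass_def sum.distrib sum_distrib_left[symmetric] sum_subtractf)
qed

lemma sum_indicator_diff:
  fixes g :: "'a \<Rightarrow> real"
  assumes "finite D" "a \<in> D" "b \<in> D"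
  shows "(\<Sum>x\<in>D. (of_bool (x = a) - of_bool (x = b)) * g x) = g a - g b"
proof -
  have "(\<Sum>x\<in>D. of_bool (x = c) * g x) = g c" if "c \<in> D" for c
  proof -
    have "(\<Sum>x\<in>D. of_bool (x = c) * g x) = (\<Sum>x\<in>D. if x = c then g x else 0)"
      by (intro sum.cong) auto
    then show ?thesis using assms(1) that by simp
  qed
  then show ?thesis using assms by (simp add: left_diff_distrib sum_subtractf)
qed

text \<open>
  Moving mass \<open>\<epsilon>\<close> from \<open>b\<close> to \<open>a\<close> changes the entropy of the image under \<open>f\<close> to first order by
  \<open>\<epsilon>\<close> times the difference of the logarithmic fibre masses; concavity of the logarithm, in the form
  \<open>ln z \<le> z - 1\<close>, bounds the second order loss.
\<close>

lemma entropy_shift_ge: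
  fixes P :: "'a \<Rightarrow> real"
  assumes D: "finite D" "a \<in> D" "b \<in> D"
    and P: "\<And>x. x \<in> D \<Longrightarrow> \<pi> \<le> P x"
    and eps: "0 \<le> \<epsilon>" "\<epsilon> < \<pi>"
    and q: "q = (\<lambda>x. P x + \<epsilon> * (of_bool (x = a) - of_bool (x = b)))"
  shows "- (\<Sum>x\<in>D. P x * ln (fibre_mass D f P x))
      + \<epsilon> * (ln (fibre_mass D f P b) - ln (fibre_mass D f P a)) - 2 / \<pi> * \<epsilon>\<^sup>2
      \<le> - (\<Sum>x\<in>D. q x * ln (fibre_mass D f q x))"
proof -
  define m where "m = fibre_mass D f P"
  define d :: "'a \<Rightarrow> real" where "d x = of_bool (f a = f x) - of_bool (f b = f x)" for x
  have pi: "0 < \<pi>" using eps by simp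
  have m_ge: "\<pi> \<le> m x" if "x \<in> D" for x
  proof -
    have "0 \<le> P z" if "z \<in> D" for z using P[OF that] pi by linarith
    then have "P x \<le> m x"
      unfolding m_def fibre_mass_def using D \<open>x \<in> D\<close> by (intro member_le_sum) auto
    then show ?thesis using P[OF that] by linarith
  qed
  have q_pos: "0 < q x" if "x \<in> D" for x
    using P[OF that] eps by (auto simp: q of_bool_def)
  have mq: "fibre_mass D f q x = m x + \<epsilon> * d x" for x
    unfolding q m_def d_def by (rule fibre_mass_shift[OF D])
  have mq_pos: "0 < m x + \<epsilon> * d x" if "x \<in> D" for x
    unfolding mq[symmetric] fibre_mass_def using q_pos D that by (intro sum_pos) auto
  have "(\<Sum>x\<in>D. q x * ln (fibre_mass D f q x)) \<le> (\<Sum>x\<in>D. q x * (ln (m x) + \<epsilon> * d x / m x))"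
  proof (intro sum_mono mult_left_mono)
    fix x assume x: "x \<in> D"
    have mp: "0 < m x" using m_ge[OF x] pi by linarith
    have "ln (m x + \<epsilon> * d x) - ln (m x) = ln ((m x + \<epsilon> * d x) / m x)"
      using mp mq_pos[OF x] by (simp add: ln_div)
    also have "\<dots> \<le> (m x + \<epsilon> * d x) / m x - 1"
      using mp mq_pos[OF x] by (intro ln_le_minus_one) auto
    finally show "ln (fibre_mass D f q x) \<le> ln (m x) + \<epsilon> * d x / m x"
      using mp by (simp add: mq add_divide_distrib)
    show "0 \<le> q x" using q_pos[OF x] by simp
  qed
  also have "\<dots> = (\<Sum>x\<in>D. P x * ln (m x)) + \<epsilon> * (\<Sum>x\<in>D. P x * d x / m x)
      + \<epsilon> * (\<Sum>x\<in>D. (of_bool (x = a) - of_bool (x = b)) * (ln (m x) + \<epsilon> * d x / m x))"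
    unfolding sum_distrib_left sum.distrib[symmetric] q
    by (intro sum.cong refl) (simp add: algebra_simps)
  \<comment> \<open>Summing \<open>P x / m x\<close> over a single fibre gives \<open>1\<close>, for the fibre of \<open>a\<close> as for that of \<open>b\<close>.\<close>
  also have "(\<Sum>x\<in>D. P x * d x / m x) = 0"
  proof -
    have "(\<Sum>x\<in>D. P x * of_bool (f c = f x) / m x) = 1" if c: "c \<in> D" for c
    proof -
      have "(\<Sum>x\<in>D. P x * of_bool (f c = f x) / m x) = (\<Sum>x\<in>{x \<in> D. f x = f c}. P x / m c)"
        using D(1) by (intro sum.mono_neutral_cong_right) (auto simp: m_def fibre_mass_def)
      also have "\<dots> = m c / m c" by (simp add: sum_divide_distrib[symmetric] m_def fibre_mass_def)
      finally show ?thesis using m_ge[OF c] pi by simp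
    qed
    from this[OF D(2)] this[OF D(3)] show ?thesis
      by (simp add: d_def right_diff_distrib diff_divide_distrib sum_subtractf)
  qed
  also have "(\<Sum>x\<in>D. (of_bool (x = a) - of_bool (x = b)) * (ln (m x) + \<epsilon> * d x / m x))
      = (ln (m a) - ln (m b)) + \<epsilon> * (d a / m a - d b / m b)"
    by (subst sum_indicator_diff[OF D]) (simp add: algebra_simps)
  also have "\<epsilon> * (ln (m a) - ln (m b) + \<epsilon> * (d a / m a - d b / m b))
      \<le> \<epsilon> * (ln (m a) - ln (m b) + \<epsilon> * (2 / \<pi>))"
  proof -
    have "d a / m a \<le> 1 / m a" "- d b / m b \<le> 1 / m b"
      using m_ge[OF D(2)] m_ge[OF D(3)] pi by (auto intro!: divide_right_mono simp: d_def of_bool_def)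
    moreover have "1 / m a \<le> 1 / \<pi>" "1 / m b \<le> 1 / \<pi>"
      using m_ge[OF D(2)] m_ge[OF D(3)] pi by (auto intro!: divide_left_mono)
    ultimately have "d a / m a - d b / m b \<le> 2 / \<pi>" by simp
    then show ?thesis using eps by (intro mult_left_mono add_left_mono)
  qed
  finally show ?thesis
    by (simp add: m_def[symmetric] algebra_simps power2_eq_square)
qed

text \<open>
  The increments of \<open>slow\<close> are the sizes of the perturbations used below. They behave like
  \<open>1 / ln t\<close>, and their initial sums have a closed form, so no sum has to be compared with an
  integral. The summand \<open>3\<close> keeps the logarithm at least \<open>1\<close>.
\<close>

definition slow :: "real \<Rightarrow> real" where "slow u = u / ln (u + 3)"

lemma one_le_ln: "0 \<le> u \<Longrightarrow> 1 \<le> ln (u + 3 :: real)"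
  using exp_le by (subst ln_ge_iff) auto

lemma slow_diff:
  assumes "0 \<le> u" "u \<le> v"
  shows "slow u \<le> slow v" "slow v - slow u \<le> (v - u) / ln (u + 3)"
proof -
  have "0 \<le> slow v - slow u \<and> slow v - slow u \<le> (v - u) / ln (u + 3)"
  proof (cases "u = v")
    case False
    then have uv: "u < v" using assms by simp
    have der: "(slow has_real_derivative 1 / ln (z + 3) - z / ((z + 3) * (ln (z + 3))\<^sup>2)) (at z)"
      if "u \<le> z" for z
    proof (rule DERIV_cong)
      have z: "0 < z + 3" "ln (z + 3) \<noteq> 0" using assms one_le_ln[of z] that by auto
      then show "(slow has_real_derivative (1 * ln (z + 3) - z * (1 / (z + 3))) / (ln (z + 3) * ln (z + 3))) (at z)"
        unfolding slow_def by (auto intro!: derivative_eq_intros)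
      have "(1 * L - z * (1 / w)) / (L * L) = 1 / L - z / (w * L\<^sup>2)" if "L \<noteq> 0" "w \<noteq> 0" for L w :: real
        using that by (simp add: field_simps power2_eq_square)
      from this[OF z(2)] z show "(1 * ln (z + 3) - z * (1 / (z + 3))) / (ln (z + 3) * ln (z + 3))
          = 1 / ln (z + 3) - z / ((z + 3) * (ln (z + 3))\<^sup>2)" by auto
    qed
    obtain z where z: "u < z" "z < v"
      "slow v - slow u = (v - u) * (1 / ln (z + 3) - z / ((z + 3) * (ln (z + 3))\<^sup>2))"
      using MVT2[OF uv, of slow "\<lambda>z. 1 / ln (z + 3) - z / ((z + 3) * (ln (z + 3))\<^sup>2)"] der by blast
    have z0: "0 \<le> z" using z assms by simp
    note l1 = one_le_ln[OF z0]
    have "z / ((z + 3) * (ln (z + 3))\<^sup>2) \<le> 1 / ln (z + 3)"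
    proof -
      have "z / (z + 3) * (1 / ln (z + 3)) * (1 / ln (z + 3)) \<le> 1 * 1 * (1 / ln (z + 3))"
        using l1 z0 by (intro mult_right_mono mult_mono) auto
      then show ?thesis by (simp add: power2_eq_square)
    qed
    moreover have "1 / ln (z + 3) \<le> 1 / ln (u + 3)"
      using one_le_ln[OF assms(1)] z assms by (intro divide_left_mono) auto
    moreover have "0 \<le> z / ((z + 3) * (ln (z + 3))\<^sup>2)" using z0 by simp
    ultimately have "0 \<le> 1 / ln (z + 3) - z / ((z + 3) * (ln (z + 3))\<^sup>2)"
      "1 / ln (z + 3) - z / ((z + 3) * (ln (z + 3))\<^sup>2) \<le> 1 / ln (u + 3)" by linarith+
    then show ?thesis using uv mult_left_mono[of _ "1 / ln (u + 3)" "v - u"] unfolding z(3) by auto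
  qed (use one_le_ln[OF assms(1)] in simp)
  then show "slow u \<le> slow v" "slow v - slow u \<le> (v - u) / ln (u + 3)" by auto
qed

lemma slow_lipschitz:
  assumes "0 \<le> u" "u \<le> v" shows "\<bar>slow v - slow u\<bar> \<le> v - u"
proof -
  have "(v - u) / ln (u + 3) \<le> (v - u) / 1"
    using one_le_ln[OF assms(1)] assms by (intro divide_left_mono) auto
  then show ?thesis using slow_diff[OF assms] by (simp add: abs_of_nonneg)
qed

text \<open>
  Since \<open>1 / ln (c k) = 1 / ln k - ln c / (ln k)\<^sup>2 + \<dots>\<close>, the deviation of \<open>slow\<close> from a linear function
  of the scaling factor \<open>c\<close> is of order \<open>k / (ln k)\<^sup>2\<close>, with coefficient \<open>- c ln c\<close>.
\<close>

lemma slow_scaling_limit: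
  assumes c: "0 < c"
  shows "(\<lambda>k. (slow (c * real k) - c * real k / ln (real k)) * ((ln (real k))\<^sup>2 / real k))
    \<longlonglongrightarrow> - c * ln c"
  using c unfolding slow_def by (real_asymp simp: field_simps)

text \<open>
  At most \<open>\<surd>k + 1\<close> terms have index below \<open>\<surd>k\<close>, and each of the others is at most
  \<open>4 / (ln k)\<^sup>2\<close>.
\<close>

lemma sum_inverse_ln_squared_le:
  "\<forall>\<^sub>F k in sequentially. (\<Sum>t<k. (1 / ln (real t + 3))\<^sup>2) \<le> 5 * (real k / (ln (real k))\<^sup>2)"
proof -
  have "\<forall>\<^sub>F k in sequentially. sqrt (real k) + 1 \<le> real k / (ln (real k))\<^sup>2" by real_asymp
  moreover have "\<forall>\<^sub>F k in sequentially. 2 \<le> real k" by real_asymp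
  ultimately show ?thesis
  proof eventually_elim
    case (elim k)
    have lk: "0 < ln (real k)" using elim by simp
    let ?r = "nat \<lceil>sqrt (real k)\<rceil>"
    have r: "sqrt (real k) \<le> real ?r" "real ?r \<le> sqrt (real k) + 1"
      by (rule real_nat_ceiling_ge) (use real_sqrt_ge_zero[of "real k"] in linarith)
    have "(\<Sum>t<k. (1 / ln (real t + 3))\<^sup>2)
        \<le> (\<Sum>t<k. (if t < ?r then 1 else 0) + 4 / (ln (real k))\<^sup>2)"
    proof (rule sum_mono)
      fix t assume "t \<in> {..<k}"
      show "(1 / ln (real t + 3))\<^sup>2 \<le> (if t < ?r then 1 else 0) + 4 / (ln (real k))\<^sup>2"
      proof (cases "t < ?r")
        case True
        have "(1 / ln (real t + 3))\<^sup>2 \<le> 1\<^sup>2"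
          using one_le_ln[of "real t"] by (intro power_mono) auto
        then show ?thesis using True by (simp add: add_increasing2)
      next
        case False
        then have "sqrt (real k) \<le> real t + 3" using r by linarith
        then have "ln (sqrt (real k)) \<le> ln (real t + 3)" using elim by (subst ln_le_cancel_iff) auto
        then have "ln (real k) / 2 \<le> ln (real t + 3)" using elim by (simp add: ln_sqrt)
        then have "(1 / ln (real t + 3))\<^sup>2 \<le> (1 / (ln (real k) / 2))\<^sup>2"
          using lk by (intro power_mono divide_left_mono) auto
        then show ?thesis using False by (simp add: power2_eq_square)
      qed
    qed
    also have "\<dots> = real (card ({..<k} \<inter> {..<?r})) + real k * (4 / (ln (real k))\<^sup>2)"
      by (simp add: sum.distrib sum.If_cases lessThan_def)
    also have "\<dots> \<le> real ?r + 4 * (real k / (ln (real k))\<^sup>2)"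
      using card_mono[of "{..<?r}" "{..<k} \<inter> {..<?r}"]
      by (intro add_mono of_nat_mono) (auto simp: mult.commute)
    also have "\<dots> \<le> 5 * (real k / (ln (real k))\<^sup>2)" using r elim by linarith
    finally show ?case .
  qed
qed

context level_system
begin

definition theta :: "nat \<Rightarrow> real" where "theta l = - lam l * ln (lam l)"

text \<open>
  The coefficient of \<open>k / (ln k)\<^sup>2\<close> in the entropy gained at scale \<open>k\<close> when mass \<open>slow (t + 1) - slow t\<close>
  is moved from \<open>b\<close> to \<open>a\<close> at time \<open>t\<close>, to first order in the size of the perturbation.
\<close>

definition gain :: "'a \<Rightarrow> 'a \<Rightarrow> real" where
  "gain a b = (\<Sum>l=1..s. (ln (pm l b) - ln (pm l a)) * (theta l - theta (l - 1)))"

lemma slow_cut_limit: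
  assumes "l \<le> s"
  shows "(\<lambda>k. (slow (real (cut l k)) - lam l * real k / ln (real k)) * ((ln (real k))\<^sup>2 / real k))
    \<longlonglongrightarrow> theta l"
proof (cases "l = 0")
  case True
  then show ?thesis by (simp add: theta_def lam_0 slow_def)
next
  case False
  then have lp: "0 < lam l" using assms by (intro lam_pos) auto
  have "(\<lambda>k. (slow (real (cut l k)) - slow (lam l * real k)) * ((ln (real k))\<^sup>2 / real k)) \<longlonglongrightarrow> 0"
  proof (rule Lim_null_comparison)
    show "\<forall>\<^sub>F k in sequentially. norm ((slow (real (cut l k)) - slow (lam l * real k)) * ((ln (real k))\<^sup>2 / real k))
      \<le> (ln (real k))\<^sup>2 / real k"
    proof (rule always_eventually, rule allI)
      fix k
      have "\<bar>slow (lam l * real k) - slow (real (cut l k))\<bar> \<le> 1"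
        using slow_lipschitz[of "real (cut l k)" "lam l * real k"] cut_le[OF assms, of k] cut_gt[OF assms, of k]
        by linarith
      then have "\<bar>slow (real (cut l k)) - slow (lam l * real k)\<bar> * ((ln (real k))\<^sup>2 / real k) \<le> 1 * ((ln (real k))\<^sup>2 / real k)"
        by (intro mult_right_mono) (auto simp: abs_minus_commute)
      then show "norm ((slow (real (cut l k)) - slow (lam l * real k)) * ((ln (real k))\<^sup>2 / real k))
        \<le> (ln (real k))\<^sup>2 / real k" by (simp add: abs_mult)
    qed
    show "(\<lambda>k. (ln (real k))\<^sup>2 / real k) \<longlonglongrightarrow> 0" by real_asymp
  qed
  from tendsto_add[OF this slow_scaling_limit[OF lp]] show ?thesis
    unfolding distrib_right[symmetric] theta_def add_0_left by simp
qed

text \<open>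
  The terms of order \<open>k / ln k\<close> cancel because \<open>a\<close> and \<open>b\<close> have the same balanced sum.
\<close>

lemma gain_limit:
  assumes "a \<in> D" "b \<in> D"
  shows "(\<lambda>k. (\<Sum>l=1..s. (ln (pm l b) - ln (pm l a)) * (slow (real (cut l k)) - slow (real (cut (l - 1) k))))
     * ((ln (real k))\<^sup>2 / real k)) \<longlonglongrightarrow> gain a b"
proof -
  \<comment> \<open>Subtracting \<open>lam l * k / ln k\<close> from each \<open>slow (cut l k)\<close> isolates the terms of the right order.\<close>
  have "(\<lambda>k. \<Sum>l=1..s. (ln (pm l b) - ln (pm l a)) *
      ((slow (real (cut l k)) - lam l * real k / ln (real k)) * ((ln (real k))\<^sup>2 / real k)
      - (slow (real (cut (l - 1) k)) - lam (l - 1) * real k / ln (real k)) * ((ln (real k))\<^sup>2 / real k)))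
    \<longlonglongrightarrow> gain a b"
    unfolding gain_def by (intro tendsto_sum tendsto_mult tendsto_diff tendsto_const slow_cut_limit) auto
  moreover have "(\<Sum>l=1..s. (ln (pm l b) - ln (pm l a)) *
      ((slow (real (cut l k)) - lam l * real k / ln (real k)) * ((ln (real k))\<^sup>2 / real k)
      - (slow (real (cut (l - 1) k)) - lam (l - 1) * real k / ln (real k)) * ((ln (real k))\<^sup>2 / real k)))
    = (\<Sum>l=1..s. (ln (pm l b) - ln (pm l a)) * (slow (real (cut l k)) - slow (real (cut (l - 1) k))))
     * ((ln (real k))\<^sup>2 / real k)" for k
  proof -
    let ?u = "real k / ln (real k) * ((ln (real k))\<^sup>2 / real k)"
    have "(\<Sum>l=1..s. (ln (pm l b) - ln (pm l a)) * (lam l - lam (l - 1))) = 0"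
      using balance[OF assms(1)] balance[OF assms(2)]
      by (simp only: right_diff_distrib left_diff_distrib sum_subtractf mult.commute)
    then have "(\<Sum>l=1..s. (ln (pm l b) - ln (pm l a)) * (lam l - lam (l - 1))) * ?u = 0" by simp
    moreover have "(\<Sum>l=1..s. (ln (pm l b) - ln (pm l a)) *
      ((slow (real (cut l k)) - lam l * real k / ln (real k)) * ((ln (real k))\<^sup>2 / real k)
      - (slow (real (cut (l - 1) k)) - lam (l - 1) * real k / ln (real k)) * ((ln (real k))\<^sup>2 / real k)))
      = (\<Sum>l=1..s. (ln (pm l b) - ln (pm l a)) * (slow (real (cut l k)) - slow (real (cut (l - 1) k))))
       * ((ln (real k))\<^sup>2 / real k)
       - (\<Sum>l=1..s. (ln (pm l b) - ln (pm l a)) * (lam l - lam (l - 1))) * ?u"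
      unfolding sum_distrib_right sum_subtractf[symmetric]
    proof (rule sum.cong[OF refl])
      fix l
      have "A * ((x - y * K / L) * G - (x' - y' * K / L) * G) = A * (x - x') * G - A * (y - y') * (K / L * G)"
        for A x x' y y' K L G :: real
        by (simp add: diff_divide_distrib left_diff_distrib right_diff_distrib)
      then show "(ln (pm l b) - ln (pm l a)) *
        ((slow (real (cut l k)) - lam l * real k / ln (real k)) * ((ln (real k))\<^sup>2 / real k)
        - (slow (real (cut (l - 1) k)) - lam (l - 1) * real k / ln (real k)) * ((ln (real k))\<^sup>2 / real k))
        = (ln (pm l b) - ln (pm l a)) * (slow (real (cut l k)) - slow (real (cut (l - 1) k)))
          * ((ln (real k))\<^sup>2 / real k)
        - (ln (pm l b) - ln (pm l a)) * (lam l - lam (l - 1)) * ?u" .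
    qed
    ultimately show ?thesis by simp
  qed
  ultimately show ?thesis by simp
qed

text \<open>
  A slowly decaying perturbation of \<open>P\<close> whose total entropy at scale \<open>k\<close> exceeds \<open>k h\<close> by a multiple
  of \<open>k / (ln k)\<^sup>2\<close>. The gain is linear in the factor \<open>c\<close> of the perturbation, the second order loss
  is quadratic, so a small \<open>c\<close> leaves a net gain.
\<close>

lemma entropy_gain:
  assumes ab: "a \<in> D" "b \<in> D" and gain_pos: "0 < gain a b"
  obtains q :: "nat \<Rightarrow> 'a \<Rightarrow> real" and \<rho> \<eta> :: real and k0 :: nat
  where "0 < \<rho>" "0 < \<eta>" "\<And>t x. x \<in> D \<Longrightarrow> \<rho> \<le> q t x" "\<And>t. sum (q t) D = 1"
    "\<And>k. k0 \<le> k \<Longrightarrow> real k * h + 2 * \<eta> * (real k / (ln (real k))\<^sup>2)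
      \<le> (\<Sum>t<k. - (\<Sum>x\<in>D. q t x * ln (fibre_mass D (tau (lev k t)) (q t) x)))"
proof -
  define \<pi> where "\<pi> = Min (P ` D)"
  have pi: "0 < \<pi>" using finite_D D_nonempty P_pos by (auto simp: \<pi>_def)
  have P_ge: "\<pi> \<le> P x" if "x \<in> D" for x using that finite_D by (auto simp: \<pi>_def)
  \<comment> \<open>The second bound makes the quadratic loss at most half of the linear gain: the loss is at
    most \<open>2 / \<pi> * c\<^sup>2 * 5\<close> and the gain \<open>c * gain a b\<close>, both times \<open>k / (ln k)\<^sup>2\<close>.\<close>
  define c where "c = min (\<pi> / 2) (gain a b * \<pi> / 20)"
  have c: "0 < c" "c \<le> \<pi> / 2" "10 * c / \<pi> \<le> gain a b / 2"
    using pi gain_pos by (auto simp: c_def field_simps min_def)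
  define \<epsilon> where "\<epsilon> t = c * (slow (real t + 1) - slow (real t))" for t :: nat
  define q where "q t x = P x + \<epsilon> t * (of_bool (x = a) - of_bool (x = b))" for t x
  have eps: "0 \<le> \<epsilon> t" "\<epsilon> t \<le> c * (1 / ln (real t + 3))" for t
    using slow_diff[of "real t" "real t + 1"] c
      mult_left_mono[of "slow (real t + 1) - slow (real t)" "1 / ln (real t + 3)" c]
    unfolding \<epsilon>_def by auto
  have eps_c: "\<epsilon> t \<le> c" for t
  proof -
    have "c * (1 / ln (real t + 3)) \<le> c * 1"
      using one_le_ln[of "real t"] c by (intro mult_left_mono) auto
    then show ?thesis using eps(2)[of t] by simp
  qed
  have eps_sum: "(\<Sum>t<n. \<epsilon> t) = c * slow (real n)" for n
  proof (induction n)
    case (Suc n)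
    then show ?case by (simp add: \<epsilon>_def algebra_simps)
  qed (simp add: slow_def)
  \<comment> \<open>In units of \<open>\<eta>\<close>: the gain is eventually at least \<open>7\<close>, the quadratic loss at most \<open>4\<close>, and the
    rounding error \<open>C\<close> at most \<open>1\<close>.\<close>
  define \<eta> where "\<eta> = c * gain a b / 8"
  have eta: "0 < \<eta>" using c gain_pos by (simp add: \<eta>_def)
  define H where "H l = - (\<Sum>x\<in>D. P x * ln (pm l x))" for l
  define A where "A l = ln (pm l b) - ln (pm l a)" for l
  have q_ge: "\<pi> / 2 \<le> q t x" if "x \<in> D" for t x
    using P_ge[OF that] eps(1)[of t] eps_c[of t] c by (auto simp: q_def of_bool_def)
  have q_sum: "sum (q t) D = 1" for t
  proof -
    have "sum (q t) D = sum P D + \<epsilon> t * (\<Sum>x\<in>D. (of_bool (x = a) - of_bool (x = b)) * 1)"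
      unfolding q_def sum.distrib sum_distrib_left by simp
    then show ?thesis unfolding sum_indicator_diff[OF finite_D ab] P_sum by simp
  qed
  have H_nonneg: "0 \<le> H l" for l
  proof -
    have "P x * ln (pm l x) \<le> 0" if "x \<in> D" for x
      using P_pos[OF that] pm_pos[OF that] pm_le_1[OF that] by (intro mult_nonneg_nonpos) auto
    then show ?thesis unfolding H_def by (simp add: sum_nonpos)
  qed
  have H_avg: "(\<Sum>l=1..s. (lam l - lam (l - 1)) * H l) = h"
  proof -
    have "(\<Sum>l=1..s. (lam l - lam (l - 1)) * H l)
        = - (\<Sum>l=1..s. \<Sum>x\<in>D. P x * ((lam l - lam (l - 1)) * ln (pm l x)))"
      unfolding H_def sum_distrib_left sum_negf[symmetric] by (simp add: algebra_simps sum_distrib_left)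
    also have "\<dots> = - (\<Sum>x\<in>D. P x * - h)"
      by (subst sum.swap) (simp only: sum_distrib_left[symmetric] balance cong: sum.cong)
    also have "\<dots> = h" by (simp add: sum_distrib_right[symmetric] P_sum sum_negf)
    finally show ?thesis .
  qed
  define C where "C = (\<Sum>l=1..s. H l)"
  have main: "real k * h - C + c * (\<Sum>l=1..s. A l * (slow (real (cut l k)) - slow (real (cut (l - 1) k))))
      - 2 / \<pi> * c\<^sup>2 * (\<Sum>t<k. (1 / ln (real t + 3))\<^sup>2)
      \<le> (\<Sum>t<k. - (\<Sum>x\<in>D. q t x * ln (fibre_mass D (tau (lev k t)) (q t) x)))" for k
  proof -
    have "(\<Sum>t<k. (H (lev k t) + \<epsilon> t * A (lev k t)) - 2 / \<pi> * (\<epsilon> t)\<^sup>2)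
        \<le> (\<Sum>t<k. - (\<Sum>x\<in>D. q t x * ln (fibre_mass D (tau (lev k t)) (q t) x)))"
    proof (rule sum_mono)
      fix t
      show "(H (lev k t) + \<epsilon> t * A (lev k t)) - 2 / \<pi> * (\<epsilon> t)\<^sup>2
        \<le> - (\<Sum>x\<in>D. q t x * ln (fibre_mass D (tau (lev k t)) (q t) x))"
        unfolding H_def A_def
        by (rule entropy_shift_ge[OF finite_D ab P_ge])
           (use eps(1)[of t] eps_c[of t] c pi in \<open>auto simp: q_def fun_eq_iff\<close>)
    qed
    moreover have "(\<Sum>t<k. H (lev k t) + \<epsilon> t * A (lev k t))
        = (\<Sum>l=1..s. (real (cut l k) - real (cut (l - 1) k)) * H l)
        + c * (\<Sum>l=1..s. A l * (slow (real (cut l k)) - slow (real (cut (l - 1) k))))"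
      unfolding sum_lev[where f="\<lambda>l t. H l + \<epsilon> t * A l"] sum_distrib_left[of c] sum.distrib[symmetric]
    proof (rule sum.cong[OF refl])
      fix l
      have "(\<Sum>t<n. H l + \<epsilon> t * A l) = real n * H l + c * slow (real n) * A l" for n
        by (simp only: sum.distrib sum_distrib_right[symmetric] eps_sum) simp
      then show "(\<Sum>t<cut l k. H l + \<epsilon> t * A l) - (\<Sum>t<cut (l - 1) k. H l + \<epsilon> t * A l)
        = (real (cut l k) - real (cut (l - 1) k)) * H l
          + c * (A l * (slow (real (cut l k)) - slow (real (cut (l - 1) k))))"
        by (simp add: algebra_simps)
    qed
    moreover have "real k * h - C \<le> (\<Sum>l=1..s. (real (cut l k) - real (cut (l - 1) k)) * H l)"
    proof -
      have "real k * h - C = (\<Sum>l=1..s. ((lam l - lam (l - 1)) * real k - 1) * H l)"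
        unfolding C_def H_avg[symmetric] by (simp add: algebra_simps sum_distrib_left sum_subtractf sum.distrib)
      also have "\<dots> \<le> (\<Sum>l=1..s. (real (cut l k) - real (cut (l - 1) k)) * H l)"
      proof (intro sum_mono mult_right_mono H_nonneg)
        fix l assume "l \<in> {1..s}"
        then have "l \<le> s" "l - 1 \<le> s" by auto
        from cut_gt[OF this(1), of k] cut_le[OF this(2), of k]
        show "(lam l - lam (l - 1)) * real k - 1 \<le> real (cut l k) - real (cut (l - 1) k)"
          unfolding left_diff_distrib by linarith
      qed
      finally show ?thesis .
    qed
    moreover have "(\<Sum>t<k. 2 / \<pi> * (\<epsilon> t)\<^sup>2) \<le> 2 / \<pi> * c\<^sup>2 * (\<Sum>t<k. (1 / ln (real t + 3))\<^sup>2)"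
      unfolding sum_distrib_left
    proof (rule sum_mono)
      fix t
      have "(\<epsilon> t)\<^sup>2 \<le> (c * (1 / ln (real t + 3)))\<^sup>2" using eps[of t] by (intro power_mono)
      then have "2 / \<pi> * (\<epsilon> t)\<^sup>2 \<le> 2 / \<pi> * (c * (1 / ln (real t + 3)))\<^sup>2"
        using pi by (intro mult_left_mono) auto
      then show "2 / \<pi> * (\<epsilon> t)\<^sup>2 \<le> 2 / \<pi> * c\<^sup>2 * (1 / ln (real t + 3))\<^sup>2"
        by (simp only: power_mult_distrib mult.assoc)
    qed
    ultimately show ?thesis by (simp only: sum_subtractf)
  qed
  have "\<forall>\<^sub>F k in sequentially. 7 / 8 * gain a b < (\<Sum>l=1..s. A l * (slow (real (cut l k)) - slow (real (cut (l - 1) k))))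
     * ((ln (real k))\<^sup>2 / real k)"
    using order_tendstoD(1)[OF gain_limit[OF ab], of "7 / 8 * gain a b"] gain_pos by (simp add: A_def)
  moreover have "\<forall>\<^sub>F k in sequentially. C \<le> \<eta> * (real k / (ln (real k))\<^sup>2)"
    using eta by real_asymp
  moreover have "\<forall>\<^sub>F k in sequentially. 2 \<le> real k" by real_asymp
  ultimately have "\<forall>\<^sub>F k in sequentially. real k * h + 2 * \<eta> * (real k / (ln (real k))\<^sup>2)
      \<le> (\<Sum>t<k. - (\<Sum>x\<in>D. q t x * ln (fibre_mass D (tau (lev k t)) (q t) x)))"
    using sum_inverse_ln_squared_le
  proof eventually_elim
    case (elim k)
    let ?r = "real k / (ln (real k))\<^sup>2"
    let ?S = "\<Sum>l=1..s. A l * (slow (real (cut l k)) - slow (real (cut (l - 1) k)))"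
    have r: "0 < ?r" using elim by simp
    have "7 / 8 * gain a b \<le> ?S / ?r" using elim(1) by simp
    then have "7 / 8 * gain a b * ?r \<le> ?S" using r by (simp only: pos_le_divide_eq)
    then have "c * (7 / 8 * gain a b * ?r) \<le> c * ?S" using c by (intro mult_left_mono) auto
    then have 1: "7 * \<eta> * ?r \<le> c * ?S" by (simp add: \<eta>_def)
    have "2 / \<pi> * c\<^sup>2 * (\<Sum>t<k. (1 / ln (real t + 3))\<^sup>2) \<le> 2 / \<pi> * c\<^sup>2 * (5 * ?r)"
      using pi elim by (intro mult_left_mono) auto
    also have "\<dots> = c * ?r * (10 * c / \<pi>)" by (simp add: power2_eq_square ac_simps)
    also have "\<dots> \<le> c * ?r * (gain a b / 2)" using c r by (intro mult_left_mono) auto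
    also have "\<dots> = 4 * \<eta> * ?r" by (simp add: \<eta>_def ac_simps)
    finally show ?case using main[of k] 1 elim by linarith
  qed
  then obtain k0 where "\<And>k. k0 \<le> k \<Longrightarrow> real k * h + 2 * \<eta> * (real k / (ln (real k))\<^sup>2)
      \<le> (\<Sum>t<k. - (\<Sum>x\<in>D. q t x * ln (fibre_mass D (tau (lev k t)) (q t) x)))"
    by (auto simp: eventually_sequentially)
  then show thesis using that[of "\<pi> / 2" \<eta> q k0] pi eta q_ge q_sum by auto
qed

end

section \<open>A measure with light cubes\<close>

context level_system
begin

abbreviation cube :: "nat \<Rightarrow> (nat \<Rightarrow> 'a) \<Rightarrow> (nat \<Rightarrow> 'a) set" where
  "cube k x \<equiv> {y. cube_word k y = cube_word k x}"

text \<open>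
  The product of the perturbed digit distributions. The logarithm of the mass of an approximate cube
  is a sum of independent bounded variables, with mean at least \<open>k h + 2 \<eta> k / (ln k)\<^sup>2\<close> in absolute
  value. By Hoeffding's inequality a deviation of \<open>\<eta> k / (ln k)\<^sup>2\<close> has probability
  \<open>exp (- const * k / (ln k)\<^sup>4)\<close>, which is summable; hence on a set \<open>E\<close> of positive probability no
  such deviation occurs at any large scale.
\<close>

lemma light_cubes_measure:
  assumes ab: "a \<in> D" "b \<in> D" and gain_pos: "0 < gain a b"
  obtains \<nu> :: "(nat \<Rightarrow> 'a) measure" and E :: "(nat \<Rightarrow> 'a) set" and \<eta> :: real and k0 :: nat
  where "prob_space \<nu>" "0 < \<eta>" "E \<in> sets \<nu>" "0 < measure \<nu> E" "E \<subseteq> UNIV \<rightarrow> D"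
    "\<And>k x. cube k x \<in> sets \<nu>"
    "\<And>k x. x \<in> E \<Longrightarrow> k0 \<le> k \<Longrightarrow>
      measure \<nu> (cube k x) \<le> exp (- (real k * h + \<eta> * (real k / (ln (real k))\<^sup>2)))"
proof -
  obtain q :: "nat \<Rightarrow> 'a \<Rightarrow> real" and \<rho> \<eta> :: real and k0 :: nat
    where rho: "0 < \<rho>" and eta: "0 < \<eta>" and q_ge: "\<And>t x. x \<in> D \<Longrightarrow> \<rho> \<le> q t x"
      and q_sum: "\<And>t. sum (q t) D = 1"
      and entropy: "\<And>k. k0 \<le> k \<Longrightarrow> real k * h + 2 * \<eta> * (real k / (ln (real k))\<^sup>2)
      \<le> (\<Sum>t<k. - (\<Sum>x\<in>D. q t x * ln (fibre_mass D (tau (lev k t)) (q t) x)))"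
    by (rule entropy_gain[OF ab gain_pos]) (rule that, assumption+)
  have q_nn: "0 \<le> q t x" if "x \<in> D" for t x using q_ge[OF that, of t] rho by simp
  define Q where "Q t = embed_pmf (\<lambda>x. if x \<in> D then q t x else 0)" for t
  have pmf_Q: "pmf (Q t) x = (if x \<in> D then q t x else 0)" for t x
    unfolding Q_def
  proof (rule pmf_embed_pmf)
    have "(\<integral>\<^sup>+ x. ennreal (if x \<in> D then q t x else 0) \<partial>count_space UNIV)
        = (\<Sum>x\<in>D. ennreal (if x \<in> D then q t x else 0))"
      using finite_D by (intro nn_integral_count_space') auto
    also have "\<dots> = ennreal (\<Sum>x\<in>D. if x \<in> D then q t x else 0)"
      using q_nn by (intro sum_ennreal) auto
    also have "\<dots> = 1" using q_sum[of t] by simp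
    finally show "(\<integral>\<^sup>+ x. ennreal (if x \<in> D then q t x else 0) \<partial>count_space UNIV) = 1" .
  qed (use q_nn in auto)
  have set_Q: "set_pmf (Q t) \<subseteq> D" for t
    by (auto simp: set_pmf_eq pmf_Q split: if_splits)
  define fm where "fm k t = fibre_mass D (tau (lev k t)) (q t)" for k t
  have prob_fibre: "measure_pmf.prob (Q t) {z. f z = f x} = fibre_mass D f (q t) x"
    for t x and f :: "'a \<Rightarrow> 'b"
  proof -
    have "measure_pmf.prob (Q t) {z. f z = f x} = measure_pmf.prob (Q t) ({z. f z = f x} \<inter> set_pmf (Q t))"
      by (simp add: measure_Int_set_pmf)
    also have "\<dots> = measure_pmf.prob (Q t) ({z \<in> D. f z = f x} \<inter> set_pmf (Q t))"
      using set_Q[of t] by (intro arg_cong[where f="measure_pmf.prob (Q t)"]) auto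
    also have "\<dots> = measure_pmf.prob (Q t) {z \<in> D. f z = f x}" by (simp add: measure_Int_set_pmf)
    also have "\<dots> = fibre_mass D f (q t) x"
      unfolding fibre_mass_def using finite_D
      by (subst measure_measure_pmf_finite) (auto simp: pmf_Q)
    finally show ?thesis .
  qed
  have fm_ge: "\<rho> \<le> fm k t x" if "x \<in> D" for k t x
  proof -
    have "q t x \<le> fm k t x"
      unfolding fm_def fibre_mass_def using finite_D that q_nn by (intro member_le_sum) auto
    then show ?thesis using q_ge[OF that, of t] by simp
  qed
  have fm_le: "fm k t x \<le> 1" for k t x
    unfolding fm_def prob_fibre[symmetric] by simp
  interpret PP: product_prob_space "\<lambda>t. measure_pmf (Q t)" UNIV
    by (simp add: product_prob_space_def product_sigma_finite_def product_prob_space_axioms_def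
        measure_pmf.sigma_finite_measure_axioms measure_pmf.prob_space_axioms)
  define \<nu> where "\<nu> = PiM UNIV (\<lambda>t. measure_pmf (Q t))"
  have space_nu [simp]: "space \<nu> = UNIV" by (simp add: \<nu>_def space_PiM)
  interpret N: prob_space \<nu> unfolding \<nu>_def by (rule PP.P.prob_space_axioms)
  have comp_meas [measurable]: "(\<lambda>y. g (y t)) \<in> borel_measurable \<nu>" for g :: "'a \<Rightarrow> real" and t
    unfolding \<nu>_def by (rule measurable_compose[OF measurable_component_singleton]) auto
  have cube_eq: "cube k x = prod_emb UNIV (\<lambda>t. measure_pmf (Q t)) {..<k}
      (PiE {..<k} (\<lambda>t. {z. tau (lev k t) z = tau (lev k t) (x t)}))" for k x
    by (auto simp: prod_emb_def cube_word_def fun_eq_iff space_PiM restrict_def PiE_def extensional_def split: if_splits)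
  have cube_sets: "cube k x \<in> sets \<nu>" for k x
    unfolding cube_eq \<nu>_def by (rule sets_PiM_I) auto
  have cube_prob: "measure \<nu> (cube k x) = (\<Prod>t<k. fm k t (x t))" for k x
    unfolding cube_eq \<nu>_def fm_def
    by (subst PP.measure_PiM_emb) (auto simp: prob_fibre)
  define X where "X k t y = (if y t \<in> D then - ln (fm k t (y t)) else 0)" for k t and y :: "nat \<Rightarrow> 'a"
  define B where "B = 1 - ln \<rho>"
  have "\<rho> \<le> 1" using fm_ge[OF ab(1)] fm_le order_trans by blast
  then have B: "1 \<le> B" using rho by (simp add: B_def)
  have X_bnd: "X k t y \<in> {0..B}" for k t y
  proof (cases "y t \<in> D")
    case True
    have "ln \<rho> \<le> ln (fm k t (y t))" "ln (fm k t (y t)) \<le> 0"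
      using fm_ge[OF True, of k t] fm_le[of k t "y t"] rho by auto
    then show ?thesis using True by (simp add: X_def B_def)
  qed (use B in \<open>simp add: X_def\<close>)
  have X_meas [measurable]: "X k t \<in> borel_measurable \<nu>" for k t
    unfolding X_def[abs_def] by (rule comp_meas[of "\<lambda>z. if z \<in> D then - ln (fm k t z) else 0"])
  have coord_indep: "N.indep_vars (\<lambda>t. measure_pmf (Q t)) (\<lambda>t y. y t) UNIV"
  proof -
    have "N.random_variable (measure_pmf (Q t)) (\<lambda>y. y t)" for t
      unfolding \<nu>_def by (rule measurable_component_singleton) simp
    moreover have "distr \<nu> (PiM UNIV (\<lambda>t. measure_pmf (Q t))) (\<lambda>y. \<lambda>t\<in>UNIV. y t)
        = PiM UNIV (\<lambda>t. distr \<nu> (measure_pmf (Q t)) (\<lambda>y. y t))"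
    proof -
      have "distr \<nu> (measure_pmf (Q t)) (\<lambda>y. y t) = measure_pmf (Q t)" for t
        unfolding \<nu>_def by (rule PP.PiM_component) simp
      moreover have "distr \<nu> (PiM UNIV (\<lambda>t. measure_pmf (Q t))) (\<lambda>y. \<lambda>t\<in>UNIV. y t) = \<nu>"
        unfolding \<nu>_def by (simp add: restrict_def distr_id)
      ultimately show ?thesis by (simp add: \<nu>_def)
    qed
    ultimately show ?thesis by (subst N.indep_vars_iff_distr_eq_PiM) auto
  qed
  have X_indep: "N.indep_vars (\<lambda>_. borel) (X k) {..<k}" for k
  proof -
    have "N.indep_vars (\<lambda>_. borel) (\<lambda>t y. (\<lambda>z. if z \<in> D then - ln (fm k t z) else 0 :: real) (y t)) UNIV"
      by (rule N.indep_vars_compose2[OF coord_indep]) auto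
    then have "N.indep_vars (\<lambda>_. borel) (X k) UNIV" by (simp add: X_def[abs_def])
    then show ?thesis by (rule N.indep_vars_subset) auto
  qed
  have X_exp: "N.expectation (X k t) = - (\<Sum>x\<in>D. q t x * ln (fm k t x))" for k t
  proof -
    let ?g = "\<lambda>z. if z \<in> D then - ln (fm k t z) else 0 :: real"
    have "distr \<nu> (measure_pmf (Q t)) (\<lambda>y. y t) = measure_pmf (Q t)"
      unfolding \<nu>_def by (rule PP.PiM_component) simp
    then have "(LINT z|measure_pmf (Q t). ?g z) = (LINT z|distr \<nu> (measure_pmf (Q t)) (\<lambda>y. y t). ?g z)"
      by simp
    also have "\<dots> = N.expectation (\<lambda>y. ?g (y t))"
      unfolding \<nu>_def by (rule integral_distr[OF measurable_component_singleton]) auto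
    also have "\<dots> = N.expectation (X k t)" by (simp add: X_def[abs_def])
    finally have "N.expectation (X k t) = (LINT z|measure_pmf (Q t). ?g z)" by simp
    also have "\<dots> = (\<Sum>x\<in>D. pmf (Q t) x *\<^sub>R ?g x)"
      using finite_D by (intro integral_measure_pmf) (auto split: if_splits)
    also have "\<dots> = - (\<Sum>x\<in>D. q t x * ln (fm k t x))"
      unfolding sum_negf[symmetric] by (intro sum.cong) (auto simp: pmf_Q)
    finally show ?thesis .
  qed
  define r where "r k = real k / (ln (real k))\<^sup>2" for k :: nat
  define bad where "bad k = {y. (\<Sum>t<k. X k t y) \<le> (\<Sum>t<k. N.expectation (X k t)) - \<eta> * r k}" for k
  have bad_sets: "bad k \<in> sets \<nu>" for k
  proof -
    have "{y \<in> space \<nu>. (\<Sum>t<k. X k t y) \<le> (\<Sum>t<k. N.expectation (X k t)) - \<eta> * r k} \<in> sets \<nu>"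
      by measurable
    then show ?thesis by (simp add: bad_def)
  qed
  have r_nn: "0 \<le> r k" for k by (simp add: r_def)
  have bad_prob: "N.prob (bad k) \<le> exp (- 2 * (\<eta> * r k)\<^sup>2 / (real k * B\<^sup>2))" if "1 \<le> k" for k
  proof -
    interpret Hoeffding_ineq \<nu> "{..<k}" "X k" "\<lambda>_. 0" "\<lambda>_. B" "\<Sum>t<k. N.expectation (X k t)"
      by unfold_locales (use X_indep X_bnd in auto)
    show ?thesis
      using Hoeffding_ineq_le[of "\<eta> * r k"] eta r_nn[of k] that B by (simp add: bad_def)
  qed
  have summ: "summable (\<lambda>k. N.prob (bad k))"
  proof (rule summable_comparison_test_ev)
    have "\<forall>\<^sub>F k in sequentially. exp (- 2 * (\<eta> * r k)\<^sup>2 / (real k * B\<^sup>2)) \<le> 1 / (real k)\<^sup>2"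
      using eta B unfolding r_def by real_asymp
    then show "\<forall>\<^sub>F k in sequentially. norm (N.prob (bad k)) \<le> 1 / (real k)\<^sup>2"
      using eventually_ge_at_top[of 1]
      by eventually_elim (use bad_prob order_trans in fastforce)
    show "summable (\<lambda>k. 1 / (real k)\<^sup>2)"
      using inverse_power_summable[of 2, where ?'a = real] by (simp add: inverse_eq_divide)
  qed
  obtain k1 where k1: "\<And>k. k1 \<le> k \<Longrightarrow> norm (\<Sum>i. N.prob (bad (i + k))) < 1 / 2"
    using suminf_exist_split[OF _ summ, of "1 / 2"] by auto
  define K where "K = max k0 k1"
  define U where "U = (\<Union>i. bad (i + K))"
  have U_sets: "U \<in> sets \<nu>" unfolding U_def using bad_sets by auto
  have "N.prob U \<le> (\<Sum>i. N.prob (bad (i + K)))"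
    unfolding U_def using bad_sets summ
    by (intro N.finite_measure_subadditive_countably) (auto intro: summable_ignore_initial_segment)
  then have U_prob: "N.prob U < 1 / 2" using k1[of K] by (simp add: K_def)
  have DD: "(UNIV \<rightarrow> D) \<in> sets \<nu>" "N.prob (UNIV \<rightarrow> D) = 1"
  proof -
    have eq: "(UNIV \<rightarrow> D) = (\<Inter>t. {y \<in> space \<nu>. y t \<in> D})" by auto
    have "{y \<in> space \<nu>. y t \<in> D} \<in> sets \<nu>" for t
      unfolding \<nu>_def by (rule sets_Collect_single') auto
    then show sets: "(UNIV \<rightarrow> D) \<in> sets \<nu>" unfolding eq by auto
    have "AE y in \<nu>. y t \<in> D" for t
      unfolding \<nu>_def using set_Q[of t] by (intro PP.AE_component) (auto simp: AE_measure_pmf_iff)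
    then have "AE y in \<nu>. y \<in> UNIV \<rightarrow> D" by (simp add: Pi_iff AE_all_countable)
    then show "N.prob (UNIV \<rightarrow> D) = 1" using sets by (simp add: N.prob_eq_1)
  qed
  define E where "E = (UNIV \<rightarrow> D) - U"
  have E_sets: "E \<in> sets \<nu>" using DD U_sets by (auto simp: E_def)
  have "N.prob E = N.prob (UNIV \<rightarrow> D) - N.prob ((UNIV \<rightarrow> D) \<inter> U)"
    unfolding E_def by (rule N.finite_measure_Diff') (use DD U_sets in auto)
  moreover have "N.prob ((UNIV \<rightarrow> D) \<inter> U) \<le> N.prob U"
    using U_sets by (intro N.finite_measure_mono) auto
  ultimately have E_pos: "0 < N.prob E" using U_prob DD by simp
  have light: "measure \<nu> (cube k x) \<le> exp (- (real k * h + \<eta> * (real k / (ln (real k))\<^sup>2)))"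
    if x: "x \<in> E" and k: "K \<le> k" for k x
  proof -
    have xD: "x t \<in> D" for t using x by (auto simp: E_def)
    have "x \<notin> bad (k - K + K)" using x by (auto simp: E_def U_def)
    then have "x \<notin> bad k" using k by simp
    then have "(\<Sum>t<k. N.expectation (X k t)) - \<eta> * r k \<le> (\<Sum>t<k. X k t x)" by (simp add: bad_def)
    moreover have "real k * h + 2 * \<eta> * r k \<le> (\<Sum>t<k. N.expectation (X k t))"
      using entropy[of k] k unfolding X_exp fm_def r_def by (simp add: K_def)
    ultimately have "real k * h + \<eta> * r k \<le> (\<Sum>t<k. X k t x)" by linarith
    moreover have "measure \<nu> (cube k x) = exp (- (\<Sum>t<k. X k t x))"
      unfolding cube_prob sum_negf[symmetric] exp_sum[OF finite_lessThan]
    proof (intro prod.cong refl)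
      fix t
      show "fm k t (x t) = exp (- X k t x)"
        using xD[of t] fm_ge[OF xD, of k t] rho by (simp add: X_def less_le_trans)
    qed
    ultimately show ?thesis by (simp add: r_def)
  qed
  show thesis
    by (rule that[OF N.prob_space_axioms eta E_sets E_pos _ cube_sets light]) (auto simp: E_def)
qed

end

section \<open>Hausdorff measure of coded sets\<close>

lemma bounded_diameter_leI:
  fixes S :: "'m::metric_space set"
  assumes "0 \<le> c" "\<And>x y. x \<in> S \<Longrightarrow> y \<in> S \<Longrightarrow> dist x y \<le> c"
  shows "bounded S" "diameter S \<le> c"
proof -
  show "bounded S" using assms(2) by (auto simp: bounded_two_points)
  show "diameter S \<le> c"
    unfolding diameter_def using assms by (auto intro!: cSUP_least)
qed

lemma gauge_le:
  assumes "0 < \<gamma>" "diameter U \<le> c" "bounded U"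
  shows "hausdorff_gauge \<gamma> U \<le> ennreal (c powr \<gamma>)"
  using assms diameter_ge_0[of U] by (auto simp: hausdorff_gauge_def intro!: ennreal_leI powr_mono2)

text \<open>
  Comparing with \<open>diameter U powr \<gamma>\<close> covers the exponent \<open>\<gamma>' = 0\<close> as well, where the gauge is \<open>1\<close> also
  on single points while \<open>0 powr 0 = 0\<close>.
\<close>

lemma gauge_ge:
  assumes "0 \<le> \<gamma>'" "\<gamma>' \<le> \<gamma>" "diameter U \<le> 1" "bounded U"
  shows "ennreal (diameter U powr \<gamma>) \<le> hausdorff_gauge \<gamma>' U"
proof (cases "U = {}")
  case False
  have d: "0 \<le> diameter U" using assms by (simp add: diameter_ge_0)
  have "diameter U powr \<gamma> \<le> 1" using d assms by (intro powr_le1) auto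
  moreover have "diameter U powr \<gamma> \<le> diameter U powr \<gamma>'" using d assms by (intro powr_mono') auto
  ultimately show ?thesis using False by (auto simp: hausdorff_gauge_def intro: ennreal_leI)
qed (simp add: hausdorff_gauge_def)

text \<open>
  A metric realisation of the symbolic system: an approximate cube of scale \<open>k\<close> has diameter of
  order \<open>N\<close> to the power \<open>- k\<close>, and a ball of that radius meets boundedly many such cubes.
\<close>

locale coded_set = level_system D tau s lam P h
  for D :: "'a set" and tau :: "nat \<Rightarrow> 'a \<Rightarrow> 'b" and s lam P h +
  fixes R :: "(nat \<Rightarrow> 'a) \<Rightarrow> 'm::metric_space" and N C :: real and M :: nat
  assumes N_gt_1: "1 < N" and C_pos: "0 < C"
    and dist_le: "\<And>k x y. x \<in> UNIV \<rightarrow> D \<Longrightarrow> y \<in> UNIV \<rightarrow> D \<Longrightarrow> cube_word k x = cube_word k y \<Longrightarrow>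
      dist (R x) (R y) \<le> C * N powr (- real k)"
    and few_words: "\<And>k x. x \<in> UNIV \<rightarrow> D \<Longrightarrow>
      finite (cube_word k ` {y \<in> UNIV \<rightarrow> D. dist (R y) (R x) \<le> N powr (- real k)}) \<and>
      card (cube_word k ` {y \<in> UNIV \<rightarrow> D. dist (R y) (R x) \<le> N powr (- real k)}) \<le> M"
begin

text \<open>
  The heavy cubes of scales \<open>k \<ge> k0\<close> cover the set, as every point lies in a heavy cube of
  arbitrarily large scale. There are at most \<open>exp (k (h + e))\<close> of them at scale \<open>k\<close>, while each
  contributes a constant times \<open>exp (- k (h + 2 e))\<close>.
\<close>

lemma hausdorff_measure_eq_0:
  assumes "h / ln N < \<gamma>"
  shows "hausdorff_measure \<gamma> (R ` (UNIV \<rightarrow> D)) = 0"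
proof -
  have lnN: "0 < ln N" using N_gt_1 by simp
  have gpos: "0 < \<gamma>" using assms h_nonneg lnN by (meson divide_nonneg_pos le_less_trans)
  define e where "e = (\<gamma> * ln N - h) / 2"
  have e: "0 < e" using assms lnN by (simp add: e_def field_simps)
  have e2: "h + 2 * e = ln N * \<gamma>" by (simp add: e_def field_simps)
  define Wd where "Wd k = cube_word k ` {x \<in> UNIV \<rightarrow> D. - (real k * (h + e)) \<le> (\<Sum>t<k. ln (pm (lev k t) (x t)))}" for k
  have Wd: "finite (Wd k)" "real (card (Wd k)) \<le> exp (real k * (h + e))" for k
    unfolding Wd_def by (rule card_heavy_words)+
  obtain w where w: "\<And>k. bij_betw (w k) {0..<card (Wd k)} (Wd k)"
    using ex_bij_betw_nat_finite[OF Wd(1)] by metis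
  define V where "V k g = R ` {x \<in> UNIV \<rightarrow> D. cube_word k x = g}" for k g
  have V: "bounded (V k g)" "diameter (V k g) \<le> C * N powr (- real k)" for k g
    by (rule bounded_diameter_leI[of "C * N powr (- real k)"]; use C_pos dist_le in \<open>force simp: V_def\<close>)+
  have V_gauge: "hausdorff_gauge \<gamma> (V k g) \<le> ennreal (C powr \<gamma> * exp (- (real k * (h + 2 * e))))" for k g
  proof -
    have "(C * N powr (- real k)) powr \<gamma> = C powr \<gamma> * exp (- (real k * (h + 2 * e)))"
      using C_pos N_gt_1 by (simp add: powr_mult powr_def[of N] exp_powr_real e2)
    then show ?thesis using gauge_le[OF gpos V(2,1)] by metis
  qed
  have pre: "hausdorff_premeasure \<gamma> \<delta> (R ` (UNIV \<rightarrow> D)) \<le> ennreal \<epsilon>" if "0 < \<delta>" "0 < \<epsilon>" for \<delta> \<epsilon>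
  proof -
    define A where "A = C powr \<gamma> * (1 / (1 - exp (- (e / 2))))"
    have "\<forall>\<^sub>F k in sequentially. C * N powr (- real k) \<le> \<delta>"
      using N_gt_1 \<open>0 < \<delta>\<close> C_pos by real_asymp
    moreover have "\<forall>\<^sub>F k in sequentially. A * exp (- (real k * e / 2)) \<le> \<epsilon>"
      using e \<open>0 < \<epsilon>\<close> by real_asymp
    ultimately have "\<forall>\<^sub>F k in sequentially. C * N powr (- real k) \<le> \<delta> \<and> A * exp (- (real k * e / 2)) \<le> \<epsilon>"
      by eventually_elim auto
    then obtain k0 where k0: "\<And>k. k0 \<le> k \<Longrightarrow> C * N powr (- real k) \<le> \<delta>"
      "A * exp (- (real k0 * e / 2)) \<le> \<epsilon>"
      by (auto simp: eventually_sequentially)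
    define U where "U = (\<lambda>(k, i). if k0 \<le> k \<and> i < card (Wd k) then V k (w k i) else {})"
    \<comment> \<open>For \<open>k \<ge> k0\<close> half of the decay \<open>exp (- k e)\<close> is spent on a factor that is small with \<open>k0\<close>;
      the other half is a geometric series.\<close>
    define c where "c k = C powr \<gamma> * exp (- (real k0 * e / 2)) * exp (- (e / 2)) ^ k" for k
    have c_nn: "0 \<le> c k" for k by (simp add: c_def)
    have geo: "norm (exp (- (e / 2))) < 1" using e by simp
    have c_sums: "c sums (C powr \<gamma> * exp (- (real k0 * e / 2)) * (1 / (1 - exp (- (e / 2)))))"
      unfolding c_def by (intro sums_mult geometric_sums geo)
    have c_sum: "(\<Sum>k. ennreal (c k)) = ennreal (A * exp (- (real k0 * e / 2)))"
      using suminf_ennreal2[OF c_nn sums_summable[OF c_sums]] sums_unique[OF c_sums]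
      by (simp add: A_def ac_simps)
    have inner: "(\<Sum>i. hausdorff_gauge \<gamma> (U (k, i))) \<le> ennreal (c k)" for k
    proof (cases "k0 \<le> k")
      case True
      have "(\<Sum>i. hausdorff_gauge \<gamma> (U (k, i))) = (\<Sum>i<card (Wd k). hausdorff_gauge \<gamma> (U (k, i)))"
        by (intro suminf_finite) (auto simp: U_def hausdorff_gauge_def)
      also have "\<dots> \<le> (\<Sum>i<card (Wd k). ennreal (C powr \<gamma> * exp (- (real k * (h + 2 * e)))))"
        using V_gauge True by (intro sum_mono) (auto simp: U_def)
      also have "\<dots> = ennreal (real (card (Wd k)) * (C powr \<gamma> * exp (- (real k * (h + 2 * e)))))"
        by (subst sum_ennreal) auto
      also have "\<dots> \<le> ennreal (exp (real k * (h + e)) * (C powr \<gamma> * exp (- (real k * (h + 2 * e)))))"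
        using Wd(2) by (intro ennreal_leI mult_right_mono) auto
      also have "exp (real k * (h + e)) * (C powr \<gamma> * exp (- (real k * (h + 2 * e))))
          = C powr \<gamma> * exp (- (real k * e))"
        by (simp add: algebra_simps flip: exp_add)
      also have "ennreal \<dots> \<le> ennreal (c k)"
      proof (rule ennreal_leI)
        have "exp (- (real k * e)) \<le> exp (- (real k0 * e / 2) + real k * (- (e / 2)))"
          using True e by (simp add: field_simps)
        then have "exp (- (real k * e)) \<le> exp (- (real k0 * e / 2)) * exp (- (e / 2)) ^ k"
          by (simp only: exp_add exp_of_nat_mult)
        then show "C powr \<gamma> * exp (- (real k * e)) \<le> c k"
          unfolding c_def mult.assoc by (intro mult_left_mono) auto
      qed
      finally show ?thesis .
    qed (simp add: U_def hausdorff_gauge_def)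
    have "(\<Sum>j. hausdorff_gauge \<gamma> (U (prod_decode j))) = (\<Sum>k. \<Sum>i. hausdorff_gauge \<gamma> (U (k, i)))"
      by (rule suminf_ennreal_2dimen) simp
    also have "\<dots> \<le> (\<Sum>k. ennreal (c k))" by (intro suminf_le inner) auto
    also have "\<dots> \<le> ennreal \<epsilon>" unfolding c_sum using k0(2) by (rule ennreal_leI)
    finally have sum_le: "(\<Sum>j. hausdorff_gauge \<gamma> (U (prod_decode j))) \<le> ennreal \<epsilon>" .
    have cover: "R ` (UNIV \<rightarrow> D) \<subseteq> (\<Union>j. U (prod_decode j))"
    proof
      fix y assume "y \<in> R ` (UNIV \<rightarrow> D)"
      then obtain x where x: "x \<in> UNIV \<rightarrow> D" and y: "y = R x" by auto
      obtain k where k: "k0 \<le> k" "- real k * (h + e) \<le> (\<Sum>t<k. ln (pm (lev k t) (x t)))"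
        using cube_mass_infinitely_often_large[OF x e] by blast
      then have "cube_word k x \<in> Wd k" using x by (auto simp: Wd_def)
      then obtain i where i: "i < card (Wd k)" "w k i = cube_word k x"
        using w[of k] unfolding bij_betw_def by (metis (no_types, lifting) atLeastLessThan_iff imageE)
      have "y \<in> U (prod_decode (prod_encode (k, i)))"
        using k i x y by (auto simp: U_def V_def)
      then show "y \<in> (\<Union>j. U (prod_decode j))" by blast
    qed
    have "bounded (U p) \<and> diameter (U p) \<le> \<delta>" for p
      using V k0(1) \<open>0 < \<delta>\<close> order_trans[OF V(2) k0(1)] by (cases p) (auto simp: U_def)
    then show ?thesis
      unfolding hausdorff_premeasure_def using cover sum_le
      by (intro INF_lower2[where i="\<lambda>j. U (prod_decode j)"]) auto
  qed
  have "hausdorff_premeasure \<gamma> \<delta> (R ` (UNIV \<rightarrow> D)) = 0" if "0 < \<delta>" for \<delta>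
  proof -
    have "hausdorff_premeasure \<gamma> \<delta> (R ` (UNIV \<rightarrow> D)) \<le> 0"
      by (rule ennreal_le_epsilon) (use pre[OF that] in simp)
    then show ?thesis by simp
  qed
  then show ?thesis by (simp add: hausdorff_measure_def)
qed

text \<open>
  Mass distribution: the part of \<open>E\<close> mapped into a set of diameter about \<open>N\<close> to the power \<open>- k\<close> lies
  in at most \<open>M\<close> cubes, all of them light. So the set carries at most \<open>\<epsilon>\<close> times its diameter to the power \<open>h / ln N\<close>,
  where \<open>\<epsilon>\<close> tends to \<open>0\<close> with the diameter because of the factor \<open>exp (- \<eta> k / (ln k)\<^sup>2)\<close>.
\<close>

lemma hausdorff_measure_eq_top:
  assumes ab: "a \<in> D" "b \<in> D" and gain_pos: "0 < gain a b"
    and gam: "0 \<le> \<gamma>" "\<gamma> \<le> h / ln N"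
  shows "hausdorff_measure \<gamma> (R ` (UNIV \<rightarrow> D)) = \<infinity>"
proof -
  have lnN: "0 < ln N" using N_gt_1 by simp
  obtain \<nu> :: "(nat \<Rightarrow> 'a) measure" and E :: "(nat \<Rightarrow> 'a) set" and \<eta> :: real and k0 :: nat
    where nu: "prob_space \<nu>" and eta: "0 < \<eta>" and E: "E \<in> sets \<nu>" "0 < measure \<nu> E" "E \<subseteq> UNIV \<rightarrow> D"
    and cube_sets: "\<And>k x. cube k x \<in> sets \<nu>"
    and light: "\<And>k x. x \<in> E \<Longrightarrow> k0 \<le> k \<Longrightarrow>
      measure \<nu> (cube k x) \<le> exp (- (real k * h + \<eta> * (real k / (ln (real k))\<^sup>2)))"
    by (rule light_cubes_measure[OF ab gain_pos]) (rule that, assumption+)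
  interpret prob_space \<nu> by (rule nu)
  define dim where "dim = h / ln N"
  have dim: "0 \<le> dim" using h_nonneg lnN by (simp add: dim_def)
  define r where "r k = real k / (ln (real k))\<^sup>2" for k :: nat
  have mass: "\<exists>A\<in>sets \<nu>. {x \<in> E. R x \<in> U} \<subseteq> A \<and> prob A \<le> real M * exp (- (real k * h + \<eta> * r k))"
    if U: "bounded U" "diameter U \<le> N powr (- real k)" and k: "k0 \<le> k" for U k
  proof (cases "{x \<in> E. R x \<in> U} = {}")
    case False
    then obtain x0 where x0: "x0 \<in> E" "R x0 \<in> U" by auto
    define G where "G = cube_word k ` {x \<in> E. R x \<in> U}"
    let ?W = "cube_word k ` {y \<in> UNIV \<rightarrow> D. dist (R y) (R x0) \<le> N powr (- real k)}"
    have "dist (R y) (R x0) \<le> N powr (- real k)" if "R y \<in> U" for y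
      using diameter_bounded_bound[OF U(1) that x0(2)] U(2) by simp
    then have sub: "G \<subseteq> ?W" unfolding G_def using E(3) by (intro image_mono) auto
    have W: "finite ?W" "card ?W \<le> M" using few_words[of x0 k] x0 E(3) by auto
    have G: "finite G" "card G \<le> M"
      using finite_subset[OF sub W(1)] card_mono[OF W(1) sub] W(2) by auto
    define A where "A = (\<Union>g\<in>G. {y. cube_word k y = g})"
    have sets: "{y. cube_word k y = g} \<in> sets \<nu>" "prob {y. cube_word k y = g} \<le> exp (- (real k * h + \<eta> * r k))"
      if "g \<in> G" for g
      using that cube_sets light[OF _ k] by (auto simp: G_def r_def)
    have "prob A \<le> (\<Sum>g\<in>G. prob {y. cube_word k y = g})"
      unfolding A_def using G sets by (intro finite_measure_subadditive_finite) auto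
    also have "\<dots> \<le> (\<Sum>g\<in>G. exp (- (real k * h + \<eta> * r k)))" using sets by (intro sum_mono)
    also have "\<dots> \<le> real M * exp (- (real k * h + \<eta> * r k))" using G by (simp add: mult_right_mono)
    finally have "prob A \<le> real M * exp (- (real k * h + \<eta> * r k))" .
    moreover have "A \<in> sets \<nu>" unfolding A_def using G sets by auto
    moreover have "{x \<in> E. R x \<in> U} \<subseteq> A" by (auto simp: A_def G_def)
    ultimately show ?thesis by blast
  next
    case True
    then show ?thesis by (intro bexI[of _ "{}"]) auto
  qed
  have decay: "\<forall>\<^sub>F k in sequentially. K * exp (- (\<eta> * r k)) \<le> \<epsilon>" if "0 < \<epsilon>" for K \<epsilon> :: real
    using eta that unfolding r_def by real_asymp
  \<comment> \<open>The preimage of \<open>U\<close> need not be measurable, hence the measurable superset \<open>A\<close>. The summand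
    \<open>\<kappa>\<close> takes care of sets of diameter \<open>0\<close>, for which \<open>k\<close> can be taken as large as needed.\<close>
  have frostman: "\<exists>\<delta>>0. \<forall>U \<kappa>. 0 < \<kappa> \<longrightarrow> bounded U \<longrightarrow> diameter U \<le> \<delta> \<longrightarrow>
      (\<exists>A\<in>sets \<nu>. {x \<in> E. R x \<in> U} \<subseteq> A \<and> prob A \<le> \<epsilon> * diameter U powr dim + \<kappa>)" if eps: "0 < \<epsilon>" for \<epsilon>
  proof -
    have "\<forall>\<^sub>F k in sequentially. k0 \<le> k \<and> real M * N powr dim * exp (- (\<eta> * r k)) \<le> \<epsilon>"
      by (intro eventually_conj decay eps eventually_ge_at_top)
    then obtain k1 where k1: "k0 \<le> k1" "\<And>k. k1 \<le> k \<Longrightarrow> real M * N powr dim * exp (- (\<eta> * r k)) \<le> \<epsilon>"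
      by (auto simp: eventually_sequentially)
    show ?thesis
    proof (intro exI[of _ "N powr (- real k1)"] conjI allI impI)
      show "0 < N powr (- real k1)" using N_gt_1 by simp
      fix U :: "'m set" and \<kappa> :: real
      assume kappa: "0 < \<kappa>" and U: "bounded U" "diameter U \<le> N powr (- real k1)"
      show "\<exists>A\<in>sets \<nu>. {x \<in> E. R x \<in> U} \<subseteq> A \<and> prob A \<le> \<epsilon> * diameter U powr dim + \<kappa>"
      proof (cases "diameter U = 0")
        case True
        have "\<forall>\<^sub>F k in sequentially. k1 \<le> k \<and> real M * exp (- (\<eta> * r k)) \<le> \<kappa>"
          by (intro eventually_conj decay kappa eventually_ge_at_top)
        then obtain k where k: "k1 \<le> k" "real M * exp (- (\<eta> * r k)) \<le> \<kappa>"
          by (auto simp: eventually_sequentially)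
        obtain A where A: "A \<in> sets \<nu>" "{x \<in> E. R x \<in> U} \<subseteq> A" "prob A \<le> real M * exp (- (real k * h + \<eta> * r k))"
          using mass[OF U(1), of k] True k k1 by auto
        have "real M * exp (- (real k * h + \<eta> * r k)) \<le> real M * exp (- (\<eta> * r k))"
          using h_nonneg by (intro mult_left_mono) auto
        then show ?thesis using A k True by (intro bexI[of _ A]) auto
      next
        case False
        then have d: "0 < diameter U" using diameter_ge_0[OF U(1)] by simp
        define k where "k = nat \<lfloor>- log N (diameter U)\<rfloor>"
        have "log N (diameter U) \<le> - real k1"
          using U(2) d N_gt_1 by (subst log_le_iff) auto
        then have k1k: "k1 \<le> k" unfolding k_def by linarith
        have kk: "real k \<le> - log N (diameter U)" "- log N (diameter U) < real k + 1"
          using \<open>log N (diameter U) \<le> - real k1\<close> unfolding k_def by linarith+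
        have dk: "diameter U \<le> N powr (- real k)" 
          using kk(1) d N_gt_1 by (subst log_le_iff[symmetric]) auto
        obtain A where A: "A \<in> sets \<nu>" "{x \<in> E. R x \<in> U} \<subseteq> A" "prob A \<le> real M * exp (- (real k * h + \<eta> * r k))"
          using mass[OF U(1) dk] k1k k1 by auto
        have "N powr (- (real k + 1)) \<le> diameter U"
          using kk(2) d N_gt_1 by (subst le_log_iff[symmetric]) auto
        then have "(N powr (- (real k + 1))) powr dim \<le> diameter U powr dim"
          using dim by (intro powr_mono2) auto
        moreover have "exp (- (real k * h)) = N powr dim * (N powr (- (real k + 1))) powr dim"
          using N_gt_1 lnN by (simp add: powr_def dim_def flip: exp_add) (simp add: field_simps)
        ultimately have "exp (- (real k * h)) \<le> N powr dim * diameter U powr dim"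
          using N_gt_1 by (simp add: mult_left_mono)
        then have "exp (- (real k * h)) * (real M * exp (- (\<eta> * r k)))
            \<le> N powr dim * diameter U powr dim * (real M * exp (- (\<eta> * r k)))"
          by (intro mult_right_mono) auto
        also have "\<dots> = (real M * N powr dim * exp (- (\<eta> * r k))) * diameter U powr dim" by simp
        also have "\<dots> \<le> \<epsilon> * diameter U powr dim" using k1(2)[OF k1k] by (intro mult_right_mono) auto
        finally have "prob A \<le> \<epsilon> * diameter U powr dim"
          using A(3) by (simp only: minus_add_distrib exp_add mult.left_commute)
        then show ?thesis using A kappa by (intro bexI[of _ A]) auto
      qed
    qed
  qed
  define m where "m = prob E"
  have m: "0 < m" using E by (simp add: m_def)
  have pre: "ennreal (m / (2 * \<epsilon>)) \<le> hausdorff_measure \<gamma> (R ` (UNIV \<rightarrow> D))" if eps: "0 < \<epsilon>" for \<epsilon>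
  proof -
    obtain \<delta> where delta: "0 < \<delta>" and fr: "\<And>U \<kappa>. 0 < \<kappa> \<Longrightarrow> bounded U \<Longrightarrow> diameter U \<le> \<delta> \<Longrightarrow>
      \<exists>A\<in>sets \<nu>. {x \<in> E. R x \<in> U} \<subseteq> A \<and> prob A \<le> \<epsilon> * diameter U powr dim + \<kappa>"
      using frostman[OF eps] by blast
    have "ennreal (m / (2 * \<epsilon>)) \<le> hausdorff_premeasure \<gamma> (min \<delta> 1) (R ` (UNIV \<rightarrow> D))"
      unfolding hausdorff_premeasure_def
    proof (rule INF_greatest)
      fix U :: "nat \<Rightarrow> 'm set"
      assume "U \<in> {U. R ` (UNIV \<rightarrow> D) \<subseteq> (\<Union>k. U k) \<and> (\<forall>k. bounded (U k) \<and> diameter (U k) \<le> min \<delta> 1)}"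
      then have cov: "R ` (UNIV \<rightarrow> D) \<subseteq> (\<Union>k. U k)"
        and U: "\<And>k. bounded (U k)" "\<And>k. diameter (U k) \<le> \<delta>" "\<And>k. diameter (U k) \<le> 1" by auto
      \<comment> \<open>The errors \<open>\<kappa> j\<close> use up half of the mass of \<open>E\<close>.\<close>
      define \<kappa> where "\<kappa> j = m / 2 * (1 / 2) ^ Suc j" for j
      have kappa: "0 < \<kappa> j" for j using m by (simp add: \<kappa>_def)
      have "\<forall>j. \<exists>A. A \<in> sets \<nu> \<and> {x \<in> E. R x \<in> U j} \<subseteq> A \<and>
          prob A \<le> \<epsilon> * diameter (U j) powr dim + \<kappa> j"
        using fr[OF kappa U(1,2)] unfolding Bex_def by (rule allI)
      from choice[OF this] obtain A where A_all: "\<forall>j. A j \<in> sets \<nu> \<and> {x \<in> E. R x \<in> U j} \<subseteq> A j \<and>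
          prob (A j) \<le> \<epsilon> * diameter (U j) powr dim + \<kappa> j" ..
      then have A: "\<And>j. A j \<in> sets \<nu>" "\<And>j. {x \<in> E. R x \<in> U j} \<subseteq> A j"
        "\<And>j. prob (A j) \<le> \<epsilon> * diameter (U j) powr dim + \<kappa> j" by blast+
      define S where "S = (\<Sum>j. hausdorff_gauge \<gamma> (U j))"
      have "E \<subseteq> (\<Union>j. A j)"
      proof
        fix x assume x: "x \<in> E"
        then have "R x \<in> R ` (UNIV \<rightarrow> D)" using E(3) by (intro imageI) (rule subsetD)
        then obtain j where "R x \<in> U j" using cov by blast
        then show "x \<in> (\<Union>j. A j)" using A(2)[of j] x by blast
      qed
      then have "emeasure \<nu> E \<le> emeasure \<nu> (\<Union>j. A j)" using A(1) by (intro emeasure_mono) auto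
      also have "\<dots> \<le> (\<Sum>j. emeasure \<nu> (A j))" using A(1) by (intro emeasure_subadditive_countably) auto
      also have "\<dots> \<le> (\<Sum>j. ennreal \<epsilon> * hausdorff_gauge \<gamma> (U j) + ennreal (\<kappa> j))"
      proof (intro suminf_le)
        fix j
        have "emeasure \<nu> (A j) \<le> ennreal (\<epsilon> * diameter (U j) powr dim + \<kappa> j)"
          unfolding emeasure_eq_measure using A(3) by (rule ennreal_leI)
        also have "\<dots> = ennreal \<epsilon> * ennreal (diameter (U j) powr dim) + ennreal (\<kappa> j)"
          using eps kappa[of j] by (simp add: ennreal_mult ennreal_plus)
        also have "\<dots> \<le> ennreal \<epsilon> * hausdorff_gauge \<gamma> (U j) + ennreal (\<kappa> j)"
          using gauge_ge[OF gam(1), of dim "U j"] gam U by (intro add_right_mono mult_left_mono) (auto simp: dim_def)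
        finally show "emeasure \<nu> (A j) \<le> ennreal \<epsilon> * hausdorff_gauge \<gamma> (U j) + ennreal (\<kappa> j)" .
      qed auto
      also have "\<dots> = ennreal \<epsilon> * S + (\<Sum>j. ennreal (\<kappa> j))"
        unfolding S_def by (subst suminf_add[symmetric]) auto
      also have "(\<Sum>j. ennreal (\<kappa> j)) = ennreal (m / 2)"
      proof -
        have "\<kappa> sums (m / 2 * 1)" unfolding \<kappa>_def by (intro sums_mult power_half_series)
        then have \<kappa>: "summable \<kappa>" "suminf \<kappa> = m / 2" by (simp_all add: sums_iff)
        show ?thesis
          unfolding suminf_ennreal2[OF less_imp_le[OF kappa] \<kappa>(1)] \<kappa>(2) ..
      qed
      finally have le: "ennreal m \<le> ennreal \<epsilon> * S + ennreal (m / 2)"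
        by (simp add: emeasure_eq_measure m_def)
      have "ennreal (m / (2 * \<epsilon>)) \<le> S"
      proof (cases S)
        case (real v)
        then have "ennreal m \<le> ennreal (\<epsilon> * v + m / 2)" using le eps m by (simp add: ennreal_mult ennreal_plus)
        then have "m \<le> \<epsilon> * v + m / 2" using eps m real by (subst (asm) ennreal_le_iff) auto
        then have "m / (2 * \<epsilon>) \<le> v" using eps by (simp add: field_simps)
        then show ?thesis using real by (simp add: ennreal_leI)
      qed auto
      then show "ennreal (m / (2 * \<epsilon>)) \<le> (\<Sum>k. hausdorff_gauge \<gamma> (U k))" by (simp add: S_def)
    qed
    also have "\<dots> \<le> hausdorff_measure \<gamma> (R ` (UNIV \<rightarrow> D))"
      unfolding hausdorff_measure_def using delta by (intro SUP_upper) auto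
    finally show ?thesis .
  qed
  show ?thesis
  proof (rule ccontr)
    assume "\<not> ?thesis"
    then obtain v where v: "hausdorff_measure \<gamma> (R ` (UNIV \<rightarrow> D)) = ennreal v" "0 \<le> v"
      by (metis ennreal_cases infinity_ennreal_def)
    have "m / (2 * (m / (2 * (v + 1)))) = v + 1" using m v by simp
    then have "ennreal (v + 1) \<le> ennreal v"
      using pre[of "m / (2 * (v + 1))"] m v by simp
    then show False using v by (simp add: ennreal_le_iff)
  qed
qed

lemma hausdorff_measure_dim_infinite:
  assumes "a \<in> D" "b \<in> D" "0 < gain a b"
  shows "hausdorff_measure (hausdorff_dim (R ` (UNIV \<rightarrow> D))) (R ` (UNIV \<rightarrow> D)) = \<infinity>"
proof -
  have dim: "0 \<le> h / ln N" using h_nonneg N_gt_1 by simp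
  have "{\<gamma>. 0 \<le> \<gamma> \<and> hausdorff_measure \<gamma> (R ` (UNIV \<rightarrow> D)) = 0} = {h / ln N<..}"
    using hausdorff_measure_eq_0 hausdorff_measure_eq_top[OF assms] dim by force
  then have "hausdorff_dim (R ` (UNIV \<rightarrow> D)) = h / ln N" by (simp add: hausdorff_dim_def)
  then show ?thesis using hausdorff_measure_eq_top[OF assms dim] by simp
qed

end

section \<open>Digit pairs with positive gain\<close>

text \<open>
  The chord of the strictly concave function \<open>- u ln u\<close> is steeper than its tangent at the right end
  and flatter than the one at the left end.
\<close>

lemma entropy_slope_bounds:
  fixes u v :: real
  assumes "0 \<le> u" "u < v"
  shows "(v - u) * (- 1 - ln v) < - v * ln v - - u * ln u"
    and "0 < u \<Longrightarrow> - v * ln v - - u * ln u < (v - u) * (- 1 - ln u)"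
proof -
  show "(v - u) * (- 1 - ln v) < - v * ln v - - u * ln u"
  proof (cases "u = 0")
    case False
    with assms have u: "0 < u" by simp
    have "ln (v / u) < v / u - 1"
      using u assms ln_eq_minus_one[of "v / u"] by (intro le_neq_trans ln_le_minus_one) auto
    then have "u * (ln v - ln u) < u * (v / u - 1)" using u assms by (simp add: ln_div)
    then show ?thesis using u by (simp add: algebra_simps)
  qed (use assms in \<open>simp add: algebra_simps\<close>)
  assume u: "0 < u"
  have "ln (u / v) < u / v - 1"
    using u assms ln_eq_minus_one[of "u / v"] by (intro le_neq_trans ln_le_minus_one) auto
  then have "v * (ln u - ln v) < v * (u / v - 1)" using u assms by (simp add: ln_div)
  then show "- v * ln v - - u * ln u < (v - u) * (- 1 - ln u)" using u assms by (simp add: algebra_simps)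
qed

context level_system
begin

lemma gain_swap: "gain b a = - gain a b"
  unfolding gain_def sum_negf[symmetric] by (intro sum.cong) (auto simp: algebra_simps)

lemma theta_slope_decreasing:
  assumes "i \<in> {1..s}" "j \<in> {1..s}" "i < j"
  shows "(theta j - theta (j - 1)) * (lam i - lam (i - 1)) < (theta i - theta (i - 1)) * (lam j - lam (j - 1))"
proof -
  have i: "0 \<le> lam (i - 1)" "lam (i - 1) < lam i" and j: "lam (j - 1) < lam j"
    and ij: "0 < lam i" "lam i \<le> lam (j - 1)"
    using assms lam_nonneg[of "i - 1"] lam_less[of i] lam_less[of j] lam_pos[of i] lam_mono[of i "j - 1"] by auto
  define c where "c = - 1 - ln (lam i)"
  have 1: "(lam i - lam (i - 1)) * c < theta i - theta (i - 1)"
    unfolding c_def theta_def by (rule entropy_slope_bounds[OF i])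
  have "theta j - theta (j - 1) < (lam j - lam (j - 1)) * (- 1 - ln (lam (j - 1)))"
    unfolding theta_def by (rule entropy_slope_bounds) (use ij j in auto)
  also have "\<dots> \<le> (lam j - lam (j - 1)) * c"
    unfolding c_def using ij j by (intro mult_left_mono) auto
  finally have 2: "theta j - theta (j - 1) < (lam j - lam (j - 1)) * c" .
  have "(theta j - theta (j - 1)) * (lam i - lam (i - 1)) < (lam j - lam (j - 1)) * c * (lam i - lam (i - 1))"
    using 2 i by (intro mult_strict_right_mono) auto
  also have "\<dots> = (lam i - lam (i - 1)) * c * (lam j - lam (j - 1))" by simp
  also have "\<dots> < (theta i - theta (i - 1)) * (lam j - lam (j - 1))"
    using 1 j by (intro mult_strict_right_mono) auto
  finally show ?thesis .
qed

text \<open>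
  Take digits \<open>a\<close>, \<open>b\<close> that are distinguished by the fibre masses of some level \<open>i\<close>, and let \<open>A l\<close> be
  the difference of their logarithmic masses at level \<open>l\<close>. Balance gives
  \<open>\<Sum>\<^sub>l (\<lambda>\<^sub>l - \<lambda>\<^sub>l\<^sub>-\<^sub>1) A l = 0\<close> with \<open>A i \<noteq> 0\<close>, so there is a second level \<open>j\<close> with \<open>A j \<noteq> 0\<close>, and
  no third one by assumption. The relation then determines \<open>A i\<close> and \<open>A j\<close> up to a common factor.
  The gain is the same kind of sum with each term multiplied by the slope of \<open>- \<lambda> ln \<lambda>\<close> over its
  window; as the slopes at \<open>i\<close> and \<open>j\<close> differ, the gain cannot vanish too. With three active levels
  these two linear relations could hold simultaneously.
\<close>

lemma positive_gain_exists:
  assumes card_ge: "1 \<le> card {l \<in> {1..s}. \<exists>x\<in>D. \<exists>y\<in>D. pm l x \<noteq> pm l y}" (is "_ \<le> card ?S")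
    and card_le: "card {l \<in> {1..s}. \<exists>x\<in>D. \<exists>y\<in>D. pm l x \<noteq> pm l y} \<le> 2"
  shows "\<exists>a\<in>D. \<exists>b\<in>D. 0 < gain a b"
proof -
  define S where "S = ?S"
  have S_card: "1 \<le> card S" "card S \<le> 2" unfolding S_def by (rule assms)+
  have S_iff: "l \<in> S \<longleftrightarrow> l \<in> {1..s} \<and> (\<exists>x\<in>D. \<exists>y\<in>D. pm l x \<noteq> pm l y)" for l
    unfolding S_def by (rule mem_Collect_eq)
  have fin: "finite S" using S_card by (intro card_ge_0_finite) simp
  have "S \<noteq> {}" using S_card by (metis card.empty not_one_le_zero)
  then obtain i where "i \<in> S" unfolding ex_in_conv[symmetric] ..
  then obtain a b where i: "i \<in> {1..s}" and ab: "a \<in> D" "b \<in> D" and ne: "pm i a \<noteq> pm i b"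
    unfolding S_iff by (elim conjE bexE)
  define A where "A l = ln (pm l b) - ln (pm l a)" for l
  define w where "w l = lam l - lam (l - 1)" for l
  define d where "d l = theta l - theta (l - 1)" for l
  have A0: "A l = 0" if "l \<in> {1..s} - S" for l
  proof -
    have "pm l a = pm l b" using that ab unfolding Diff_iff S_iff by blast
    then show ?thesis by (simp add: A_def)
  qed
  have Ai: "A i \<noteq> 0" using ne pm_pos[OF ab(1), of i] pm_pos[OF ab(2), of i] by (simp add: A_def)
  have wpos: "0 < w l" if "l \<in> {1..s}" for l using lam_less[OF that] by (simp add: w_def)
  have balance': "(\<Sum>l=1..s. w l * A l) = 0"
    using balance[OF ab(1)] balance[OF ab(2)]
    by (simp only: w_def A_def right_diff_distrib sum_subtractf)
  have "\<exists>j\<in>{1..s}. j \<noteq> i \<and> A j \<noteq> 0"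
  proof (rule ccontr)
    assume "\<not> ?thesis"
    then have "(\<Sum>l=1..s. w l * A l) = (\<Sum>l\<in>{i}. w l * A l)"
      using i by (intro sum.mono_neutral_right) auto
    then show False using balance' Ai wpos[OF i] by simp
  qed
  then obtain j where j: "j \<in> {1..s}" "j \<noteq> i" "A j \<noteq> 0" by blast
  have "{i, j} \<subseteq> S" using A0 i j Ai by blast
  then have S: "S = {i, j}"
    using S_card j(2) fin by (intro card_seteq[symmetric]) auto
  have reduce: "(\<Sum>l=1..s. f l * A l) = f i * A i + f j * A j" for f :: "nat \<Rightarrow> real"
  proof -
    have "(\<Sum>l=1..s. f l * A l) = (\<Sum>l\<in>{i, j}. f l * A l)"
      using i j A0 S by (intro sum.mono_neutral_right) auto
    then show ?thesis using j by simp
  qed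
  have bal: "w i * A i = - (w j * A j)" using balance' unfolding reduce by simp
  have "gain a b = d i * A i + d j * A j"
    unfolding reduce[symmetric] by (simp add: gain_def A_def d_def mult.commute)
  then have "w i * gain a b = d i * (w i * A i) + w i * d j * A j" by (simp add: algebra_simps)
  also have "\<dots> = (d j * w i - d i * w j) * A j" unfolding bal by (simp add: algebra_simps)
  finally have g: "w i * gain a b = (d j * w i - d i * w j) * A j" .
  have "d j * w i \<noteq> d i * w j"
    using theta_slope_decreasing[OF i j(1)] theta_slope_decreasing[OF j(1) i] j(2)
    by (auto simp: d_def w_def neq_iff)
  with g j(3) have "gain a b \<noteq> 0" by auto
  then show ?thesis using gain_swap[of b a] ab by (metis linorder_neqE_linordered_idom neg_0_less_iff_less)
qed

end

section \<open>Digit expansions and the torus\<close>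

definition base_value :: "nat \<Rightarrow> (nat \<Rightarrow> nat) \<Rightarrow> real" where
  "base_value b a = (\<Sum>t. real (a t) / real b ^ Suc t)"

text \<open>
  The integer whose base \<open>b\<close> digits are \<open>a 0, \<dots>, a (L - 1)\<close>, most significant first.
\<close>

primrec digit_prefix :: "nat \<Rightarrow> (nat \<Rightarrow> nat) \<Rightarrow> nat \<Rightarrow> nat" where
  "digit_prefix b a 0 = 0"
| "digit_prefix b a (Suc L) = b * digit_prefix b a L + a L"

lemma digit_prefix_less:
  assumes "\<And>t. a t < b" shows "digit_prefix b a L < b ^ L"
proof (induction L)
  case (Suc L)
  have "b * digit_prefix b a L + a L < b * digit_prefix b a L + b" using assms by simp
  also have "\<dots> = b * Suc (digit_prefix b a L)" by simp
  also have "\<dots> \<le> b * b ^ L" using Suc by (intro mult_left_mono) auto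
  finally show ?case by simp
qed simp

lemma digit_prefix_inject:
  assumes "\<And>t. a t < b" "\<And>t. a' t < b" "digit_prefix b a L = digit_prefix b a' L" "t < L"
  shows "a t = a' t"
  using assms(3,4)
proof (induction L)
  case (Suc L)
  have "(b * digit_prefix b a L + a L) mod b = (b * digit_prefix b a' L + a' L) mod b"
    using Suc.prems(1) by simp
  then have 1: "a L = a' L" using assms(1,2) by simp
  have "0 < b" using assms(1)[of 0] by simp
  with Suc.prems(1) 1 have "digit_prefix b a L = digit_prefix b a' L" by simp
  with Suc 1 show ?case by (auto simp: less_Suc_eq)
qed simp

lemma digit_prefix_cong: "(\<And>t. t < L \<Longrightarrow> a t = a' t) \<Longrightarrow> digit_prefix b a L = digit_prefix b a' L"
  by (induction L) auto

lemma digit_prefix_sum: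
  assumes "0 < b"
  shows "(\<Sum>t<L. real (a t) / real b ^ Suc t) = real (digit_prefix b a L) / real b ^ L"
  using assms by (induction L) (auto simp: field_simps)

lemma base_expansion:
  assumes b: "2 \<le> b" and a: "\<And>t. a t < b"
  shows "summable (\<lambda>t. real (a t) / real b ^ Suc t)"
    and "real (digit_prefix b a L) / real b ^ L \<le> base_value b a"
    and "base_value b a \<le> (real (digit_prefix b a L) + 1) / real b ^ L"
proof -
  let ?f = "\<lambda>t. real (a t) / real b ^ Suc t"
  have le: "?f t \<le> (real b - 1) / real b ^ Suc t" for t
    using a[of t] b by (intro divide_right_mono) auto
  have geo: "(\<lambda>t. (real b - 1) / real b ^ Suc (t + L)) sums (1 / real b ^ L)"
  proof -
    have "(\<lambda>t. (real b - 1) / real b ^ Suc L * (1 / real b) ^ t) sums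
        ((real b - 1) / real b ^ Suc L * (1 / (1 - 1 / real b)))"
      using b by (intro sums_mult geometric_sums) auto
    moreover have "(real b - 1) / real b ^ Suc L * (1 / (1 - 1 / real b)) = 1 / real b ^ L"
      using b by (simp add: field_simps)
    ultimately show ?thesis by (simp add: power_add power_one_over field_simps)
  qed
  have geo0: "summable (\<lambda>t. (real b - 1) / real b ^ Suc t)"
    using summable_iff_shift[of "\<lambda>t. (real b - 1) / real b ^ Suc t" L] geo by (auto simp: sums_iff)
  show summ: "summable ?f"
    by (rule summable_comparison_test[OF _ geo0]) (use le in \<open>auto simp: abs_of_nonneg\<close>)
  have split: "base_value b a = (\<Sum>t. ?f (t + L)) + (\<Sum>t<L. ?f t)"
    unfolding base_value_def by (rule suminf_split_initial_segment[OF summ])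
  have pre: "(\<Sum>t<L. ?f t) = real (digit_prefix b a L) / real b ^ L"
    by (rule digit_prefix_sum) (use b in simp)
  have tail: "summable (\<lambda>t. ?f (t + L))" using summ by (rule summable_ignore_initial_segment)
  have "0 \<le> (\<Sum>t. ?f (t + L))" by (intro suminf_nonneg tail) auto
  moreover have "(\<Sum>t. ?f (t + L)) \<le> (\<Sum>t. (real b - 1) / real b ^ Suc (t + L))"
    by (intro suminf_le tail le) (use geo in \<open>auto simp: sums_iff\<close>)
  ultimately show "real (digit_prefix b a L) / real b ^ L \<le> base_value b a"
    "base_value b a \<le> (real (digit_prefix b a L) + 1) / real b ^ L"
    using geo unfolding split pre by (auto simp: sums_iff add_divide_distrib)
qed

lemma base_value_close:
  assumes "2 \<le> b" "\<And>t. a t < b" "\<And>t. a' t < b" "\<And>t. t < L \<Longrightarrow> a t = a' t"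
  shows "\<bar>base_value b a - base_value b a'\<bar> \<le> 1 / real b ^ L"
  using base_expansion(2,3)[where b=b and a=a and L=L] base_expansion(2,3)[where b=b and a=a' and L=L]
    digit_prefix_cong[where L=L and a=a and a'=a' and b=b] assms
  by (auto simp: add_divide_distrib)

text \<open>
  Two points at distance less than \<open>2 / b ^ L\<close> on the circle lie in closed \<open>b\<close>-adic intervals of level
  \<open>L\<close> whose numbers differ by less than \<open>3\<close> modulo \<open>b ^ L\<close>. The bound on the distance is strict, and
  the intervals are closed because expansions with all later digits \<open>b - 1\<close> occur.
\<close>

lemma digit_prefix_near:
  assumes b: "2 \<le> b" and a: "\<And>t. a t < b" "\<And>t. a' t < b"
    and near: "\<bar>base_value b a - base_value b a' - of_int z\<bar> < 2 / real b ^ L"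
  shows "\<bar>int (digit_prefix b a L) - int (digit_prefix b a' L) - z * int b ^ L\<bar> \<le> 2"
proof -
  let ?B = "real b ^ L"
  have B: "0 < ?B" using b by simp
  let ?x = "base_value b a * ?B" and ?y = "base_value b a' * ?B"
  have "real (digit_prefix b a L) \<le> ?x" "?x \<le> real (digit_prefix b a L) + 1"
    "real (digit_prefix b a' L) \<le> ?y" "?y \<le> real (digit_prefix b a' L) + 1"
    using base_expansion(2,3)[where a=a and L=L, OF b a(1)] base_expansion(2,3)[where a=a' and L=L, OF b a(2)] B
    by (simp_all only: pos_divide_le_eq pos_le_divide_eq)
  moreover have "\<bar>?x - ?y - of_int z * ?B\<bar> < 2"
  proof -
    have "\<bar>base_value b a - base_value b a' - of_int z\<bar> * ?B < 2"
      using near B by (simp only: pos_less_divide_eq)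
    then have "\<bar>(base_value b a - base_value b a' - of_int z) * ?B\<bar> < 2" using B by (simp only: abs_mult abs_of_pos)
    then show ?thesis by (simp only: left_diff_distrib)
  qed
  ultimately have "\<bar>real (digit_prefix b a L) - real (digit_prefix b a' L) - of_int z * ?B\<bar> < 3" by linarith
  then have "real_of_int \<bar>int (digit_prefix b a L) - int (digit_prefix b a' L) - z * int b ^ L\<bar> < 3"
    by simp
  then show ?thesis by linarith
qed

lemma sponge_map_eq:
  fixes m :: "'d::{finite,linorder} \<Rightarrow> nat"
  assumes "\<And>j. 2 \<le> m j" "\<And>t j. x t j < m j"
  shows "sponge_map m x = torus_of (\<chi> j. base_value (m j) (\<lambda>t. x t j))"
proof -
  have "(\<lambda>k. \<chi> j. real (x k j) / real (m j) ^ Suc k) sums (\<chi> j. base_value (m j) (\<lambda>t. x t j))"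
    unfolding sums_def
  proof (rule vec_tendstoI)
    fix j
    have "(\<lambda>k. real (x k j) / real (m j) ^ Suc k) sums base_value (m j) (\<lambda>t. x t j)"
      unfolding base_value_def by (intro summable_sums base_expansion(1)) (use assms in auto)
    then show "(\<lambda>n. (\<Sum>k<n. \<chi> j. real (x k j) / real (m j) ^ Suc k) $ j)
        \<longlonglongrightarrow> (\<chi> j. base_value (m j) (\<lambda>t. x t j)) $ j"
      by (simp add: sums_def)
  qed
  then show ?thesis by (simp add: sponge_map_def sums_iff)
qed

lemma dist_torus_of_eq: "dist (torus_of p) (torus_of q) = infdist p {y. torus_of y = torus_of q}"
  by (simp add: dist_torus_def torus_of_setdist_infdist)

lemma dist_torus_of_le: "dist (torus_of p) (torus_of q) \<le> dist p q"
  unfolding dist_torus_of_eq by (rule infdist_le) simp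

text \<open>
  The distance of two cosets is an infimum over representatives, so a strict bound holds for one of them.
\<close>

lemma dist_torus_of_less:
  fixes p q :: "real^'d::finite"
  assumes "dist (torus_of p) (torus_of q) < r"
  shows "\<exists>z. \<bar>p $ j - q $ j - of_int z\<bar> < r"
proof -
  have "{y. torus_of y = torus_of q} \<noteq> {}" by auto
  then have "(INF y\<in>{y. torus_of y = torus_of q}. dist p y) < r"
    using assms by (simp add: dist_torus_of_eq infdist_notempty)
  then obtain y where y: "torus_of y = torus_of q" "dist p y < r"
    using \<open>{y. torus_of y = torus_of q} \<noteq> {}\<close> by (subst (asm) cINF_less_iff) auto
  then have "y $ j - q $ j \<in> \<int>" by (simp add: torus_of_eq_iff torus_rel_def)
  then obtain z where z: "y $ j - q $ j = of_int z" by (auto elim: Ints_cases)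
  have "\<bar>p $ j - y $ j\<bar> < r" using dist_vec_nth_le[of p j y] y(2) by (simp add: dist_real_def)
  then show ?thesis using z by (intro exI[of _ z]) (simp add: algebra_simps)
qed

lemma card_image_le_signatures:
  assumes "finite F" "\<sigma> ` S \<subseteq> F" "\<And>x y. x \<in> S \<Longrightarrow> y \<in> S \<Longrightarrow> \<sigma> x = \<sigma> y \<Longrightarrow> c x = c y"
  shows "finite (c ` S)" "card (c ` S) \<le> card F"
proof -
  have eq: "c ` S = (\<lambda>e. c (SOME x. x \<in> S \<and> \<sigma> x = e)) ` \<sigma> ` S"
    unfolding image_image
  proof (rule image_cong[OF refl])
    fix x assume x: "x \<in> S"
    have "(SOME y. y \<in> S \<and> \<sigma> y = \<sigma> x) \<in> S \<and> \<sigma> (SOME y. y \<in> S \<and> \<sigma> y = \<sigma> x) = \<sigma> x"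
      by (rule someI_ex) (use x in auto)
    then show "c x = c (SOME y. y \<in> S \<and> \<sigma> y = \<sigma> x)" using assms(3) x by metis
  qed
  have fin: "finite (\<sigma> ` S)" using assms(1,2) by (rule finite_subset[rotated])
  then show "finite (c ` S)" unfolding eq by simp
  show "card (c ` S) \<le> card F"
    unfolding eq using card_image_le[OF fin] card_mono[OF assms(1,2)] order_trans by blast
qed

section \<open>Sponges as coded sets\<close>

lemma position_bij: "bij_betw (position :: 'd::{finite,linorder} \<Rightarrow> nat) UNIV {1..CARD('d)}"
proof -
  have less: "position i < position j" if "i < j" for i j :: 'd
  proof -
    have "j \<in> {k. k \<le> j} - {k. k \<le> i}" using that by auto
    then have "{k. k \<le> i} \<subset> {k. k \<le> j}" using that by fastforce
    then show ?thesis unfolding position_def by (intro psubset_card_mono) auto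
  qed
  have inj: "inj (position :: 'd \<Rightarrow> nat)"
    by (rule injI) (metis less less_irrefl linorder_less_linear)
  have "position j \<in> {1..CARD('d)}" for j :: 'd
  proof -
    have "card {j} \<le> position j" unfolding position_def by (intro card_mono) auto
    moreover have "position j \<le> CARD('d)" unfolding position_def by (intro card_mono) auto
    ultimately show ?thesis by simp
  qed
  then have "range (position :: 'd \<Rightarrow> nat) = {1..CARD('d)}"
    by (intro card_seteq) (auto simp: card_image[OF inj])
  with inj show ?thesis by (simp add: bij_betw_def)
qed

locale sponge_blocks =
  fixes m :: "'d::{finite,linorder} \<Rightarrow> nat"
    and D :: "('d \<Rightarrow> nat) set"
    and s :: nat
    and n dd :: "nat \<Rightarrow> nat"
  assumes m_ge_2: "\<And>j. 2 \<le> m j"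
    and s_pos: "1 \<le> s"
    and n_decreasing: "strict_antimono_on {1..s} n"
    and dd_increasing: "strict_mono_on {0..s} dd"
    and dd_0: "dd 0 = 0"
    and dd_s: "dd s = CARD('d)"
    and blocks: "\<And>i j. i \<in> {1..s} \<Longrightarrow> dd (i - 1) < position j \<Longrightarrow> position j \<le> dd i \<Longrightarrow> m j = n i"
    and D_nonempty: "D \<noteq> {}"
    and D_digits: "D \<subseteq> digits m"
begin

lemma finite_D: "finite D"
proof (rule finite_subset[OF D_digits])
  have "digits m = PiE UNIV (\<lambda>j. {..<m j})" by (auto simp: digits_def)
  then show "finite (digits m)" by (simp add: finite_PiE)
qed

lemma dd_mono: "i \<le> j \<Longrightarrow> j \<le> s \<Longrightarrow> dd i \<le> dd j"
  using strict_mono_onD[OF dd_increasing, of i j] by (cases "i = j") auto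

text \<open>
  Each block of coordinates is nonempty, so each \<open>n i\<close> is one of the numbers \<open>m j\<close>.
\<close>

lemma n_ge_2: "i \<in> {1..s} \<Longrightarrow> 2 \<le> n i"
proof -
  assume i: "i \<in> {1..s}"
  have lt: "dd (i - 1) < dd i" using strict_mono_onD[OF dd_increasing, of "i - 1" i] i by auto
  have "dd i \<le> CARD('d)" using dd_mono[of i s] i dd_s by auto
  then have "dd i \<in> {1..CARD('d)}" using lt by simp
  then have "dd i \<in> range (position :: 'd \<Rightarrow> nat)"
    using position_bij[where ?'d = 'd] unfolding bij_betw_def by simp
  then obtain j :: 'd where "position j = dd i" by auto
  then have "m j = n i" using blocks[OF i, of j] lt by simp
  then show ?thesis using m_ge_2[of j] by simp
qed

lemma n_less: "i \<in> {1..s} \<Longrightarrow> j \<in> {1..s} \<Longrightarrow> i < j \<Longrightarrow> n j < n i"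
  using n_decreasing by (auto simp: monotone_on_def)

definition block :: "'d \<Rightarrow> nat" where "block j = (LEAST i. position j \<le> dd i)"

lemma block: "block j \<in> {1..s}" "dd (block j - 1) < position j" "position j \<le> dd (block j)"
proof -
  have pos: "position j \<in> {1..CARD('d)}" using position_bij[where ?'d = 'd] by (auto simp: bij_betw_def)
  then have ex: "position j \<le> dd s" using dd_s by simp
  show 1: "position j \<le> dd (block j)"
    unfolding block_def by (rule LeastI[of "\<lambda>i. position j \<le> dd i", OF ex])
  have "block j \<le> s" unfolding block_def by (rule Least_le[of "\<lambda>i. position j \<le> dd i", OF ex])
  moreover have ne: "block j \<noteq> 0" using 1 pos dd_0 by (metis atLeastAtMost_iff not_one_le_zero order_trans)
  ultimately show "block j \<in> {1..s}" by auto
  have "block j - 1 < block j" using ne by simp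
  then have "\<not> position j \<le> dd (block j - 1)"
    unfolding block_def by (rule not_less_Least)
  then show "dd (block j - 1) < position j" by simp
qed

lemma m_eq: "m j = n (block j)"
  using blocks[OF block] .

lemma level_proj_comp:
  assumes "i \<le> j" "j \<le> s"
  shows "level_proj dd j (level_proj dd i x) = level_proj dd j x"
proof -
  have "dd (i - 1) \<le> dd (j - 1)" using assms by (intro dd_mono) auto
  then show ?thesis by (auto simp: level_proj_def fun_eq_iff)
qed

lemma level_proj_1: "level_proj dd (Suc 0) x = (x :: 'd \<Rightarrow> nat)"
proof -
  have "0 < position j" for j :: 'd using block(2)[of j] by simp
  then show ?thesis by (auto simp: level_proj_def dd_0 fun_eq_iff)
qed

abbreviation "Zl \<equiv> Zfun n dd D"
abbreviation "al \<equiv> level_exp n"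
abbreviation "pr \<equiv> level_proj dd"
abbreviation "Zt \<equiv> Ztotal n dd s D"

lemma finite_level_digits: "finite (level_digits dd D i)"
  using finite_D by (simp add: level_digits_def)

lemma Zfun_pos: "l \<in> {1..s} \<Longrightarrow> y \<in> level_digits dd D l \<Longrightarrow> 0 < Zl l y"
proof (induction l arbitrary: y)
  case (Suc l)
  show ?case
  proof (cases l)
    case (Suc i)
    obtain x where x: "x \<in> D" "y = pr (Suc l) x" using Suc.prems by (auto simp: level_digits_def)
    have "0 < (\<Sum>z\<in>{z \<in> level_digits dd D (Suc i). pr (Suc (Suc i)) z = y}. Zl (Suc i) z powr al (Suc i))"
    proof (rule sum_pos)
      show "finite {z \<in> level_digits dd D (Suc i). pr (Suc (Suc i)) z = y}"
        using finite_level_digits by simp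
      have "pr (Suc i) x \<in> {z \<in> level_digits dd D (Suc i). pr (Suc (Suc i)) z = y}"
        using x Suc Suc.prems by (auto simp: level_digits_def level_proj_comp)
      then show "{z \<in> level_digits dd D (Suc i). pr (Suc (Suc i)) z = y} \<noteq> {}" by blast
      fix z assume "z \<in> {z \<in> level_digits dd D (Suc i). pr (Suc (Suc i)) z = y}"
      then have "0 < Zl (Suc i) z" using Suc.IH[of z] Suc Suc.prems by auto
      then show "0 < Zl (Suc i) z powr al (Suc i)" by simp
    qed
    then show ?thesis by (simp add: Suc)
  qed simp
qed simp

lemma Ztotal_pos: "0 < Zt"
  unfolding Ztotal_def using finite_level_digits D_nonempty Zfun_pos[of s] s_pos
  by (intro sum_pos) (auto simp: level_digits_def intro!: powr_gt_zero[THEN iffD2] less_imp_neq[symmetric])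

abbreviation "popt \<equiv> opt_vector n dd s D"

lemma popt_pos: "x \<in> D \<Longrightarrow> 0 < popt x"
  unfolding opt_vector_def using Ztotal_pos Zfun_pos
  by (intro mult_pos_pos prod_pos) (auto simp: level_digits_def intro!: less_imp_neq[symmetric])

text \<open>
  Passing from level \<open>l\<close> to \<open>l + 1\<close>, only the factor \<open>Z\<^sup>(\<^sup>l\<^sup>)\<close> to the power \<open>\<alpha>\<^sub>l\<close> varies within a fibre;
  its sum over the fibre is \<open>Z\<^sup>(\<^sup>l\<^sup>+\<^sup>1\<^sup>)\<close>, which raises the exponent \<open>\<alpha>\<^sub>l\<^sub>+\<^sub>1 - 1\<close> of the next factor to
  \<open>\<alpha>\<^sub>l\<^sub>+\<^sub>1\<close>.
\<close>

lemma fibre_mass_popt: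
  assumes "l \<in> {1..s}" "x \<in> D"
  shows "fibre_mass D (pr l) popt x
    = 1 / Zt * Zl l (pr l x) powr al l * (\<Prod>i=Suc l..s. Zl i (pr i x) powr (al i - 1))"
  using assms
proof (induction l arbitrary: x)
  case (Suc l)
  show ?case
  proof (cases l)
    case 0
    have "{z \<in> D. pr (Suc 0) z = pr (Suc 0) x} = {x}" using Suc.prems by (auto simp: level_proj_1)
    then have "fibre_mass D (pr (Suc 0)) popt x = popt x" by (simp add: fibre_mass_def)
    also have "\<dots> = 1 / Zt * (\<Prod>i=Suc (Suc 0)..s. Zl i (pr i x) powr (al i - 1))"
      unfolding opt_vector_def using s_pos by (simp add: prod.atLeast_Suc_atMost)
    finally show ?thesis by (simp add: 0 level_exp_def)
  next
    case l: (Suc i)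
    let ?Y = "{y \<in> level_digits dd D l. pr (Suc l) y = pr (Suc l) x}"
    let ?T = "\<lambda>k. \<Prod>i=k..s. Zl i (pr i x) powr (al i - 1)"
    have "fibre_mass D (pr (Suc l)) popt x
        = (\<Sum>y\<in>?Y. \<Sum>z\<in>{z \<in> {z \<in> D. pr (Suc l) z = pr (Suc l) x}. pr l z = y}. popt z)"
      unfolding fibre_mass_def using finite_D finite_level_digits Suc.prems
      by (intro sum.group[symmetric]) (auto simp: level_digits_def level_proj_comp)
    also have "\<dots> = (\<Sum>y\<in>?Y. 1 / Zt * Zl l y powr al l * ?T (Suc l))"
    proof (rule sum.cong[OF refl])
      fix y assume y: "y \<in> ?Y"
      then obtain z0 where z0: "z0 \<in> D" "y = pr l z0" by (auto simp: level_digits_def)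
      have same: "pr i z0 = pr i x" if "i \<in> {Suc l..s}" for i
      proof -
        have "pr (Suc l) z0 = pr (Suc l) x"
          using y z0 Suc.prems by (auto simp: level_proj_comp)
        then show ?thesis using that level_proj_comp[of "Suc l" i] by (metis atLeastAtMost_iff)
      qed
      have "{z \<in> {z \<in> D. pr (Suc l) z = pr (Suc l) x}. pr l z = y} = {z \<in> D. pr l z = pr l z0}"
      proof -
        have comp: "pr (Suc l) (pr l z) = pr (Suc l) z" for z :: "'d \<Rightarrow> nat"
          using Suc.prems by (intro level_proj_comp) auto
        then have "pr (Suc l) z0 = pr (Suc l) x" using y z0 by auto
        then have "pr (Suc l) z = pr (Suc l) x" if "pr l z = pr l z0" for z
          using comp[of z] comp[of z0] that by simp
        then show ?thesis using z0 by auto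
      qed
      then have "(\<Sum>z\<in>{z \<in> {z \<in> D. pr (Suc l) z = pr (Suc l) x}. pr l z = y}. popt z)
          = fibre_mass D (pr l) popt z0" by (simp add: fibre_mass_def)
      also have "\<dots> = 1 / Zt * Zl l y powr al l * (\<Prod>i=Suc l..s. Zl i (pr i z0) powr (al i - 1))"
        using Suc.IH[of z0] z0 Suc.prems l by simp
      also have "(\<Prod>i=Suc l..s. Zl i (pr i z0) powr (al i - 1)) = ?T (Suc l)"
        using same by (intro prod.cong) auto
      finally show "(\<Sum>z\<in>{z \<in> {z \<in> D. pr (Suc l) z = pr (Suc l) x}. pr l z = y}. popt z)
          = 1 / Zt * Zl l y powr al l * ?T (Suc l)" .
    qed
    also have "\<dots> = 1 / Zt * Zl (Suc l) (pr (Suc l) x) * ?T (Suc l)"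
      by (simp add: l sum_distrib_left sum_distrib_right)
    also have "?T (Suc l) = Zl (Suc l) (pr (Suc l) x) powr (al (Suc l) - 1) * ?T (Suc (Suc l))"
      using Suc.prems by (intro prod.atLeast_Suc_atMost) auto
    also have "1 / Zt * Zl (Suc l) (pr (Suc l) x) * (Zl (Suc l) (pr (Suc l) x) powr (al (Suc l) - 1) * ?T (Suc (Suc l)))
        = 1 / Zt * Zl (Suc l) (pr (Suc l) x) powr al (Suc l) * ?T (Suc (Suc l))"
    proof -
      have "0 < Zl (Suc l) (pr (Suc l) x)" using Suc.prems by (intro Zfun_pos) (auto simp: level_digits_def)
      then have "Zl (Suc l) (pr (Suc l) x) * Zl (Suc l) (pr (Suc l) x) powr (al (Suc l) - 1)
          = Zl (Suc l) (pr (Suc l) x) powr al (Suc l)"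
        by (simp add: powr_diff)
      then show ?thesis by simp
    qed
    finally show ?thesis .
  qed
qed simp

lemma popt_sum: "sum popt D = 1"
proof -
  have s: "s \<in> {1..s}" using s_pos by simp
  have "sum popt D = (\<Sum>y\<in>level_digits dd D s. \<Sum>z\<in>{z \<in> D. pr s z = y}. popt z)"
    using finite_D by (intro sum.group[symmetric]) (auto simp: level_digits_def)
  also have "\<dots> = (\<Sum>y\<in>level_digits dd D s. 1 / Zt * Zl s y powr al s)"
  proof (rule sum.cong[OF refl])
    fix y assume "y \<in> level_digits dd D s"
    then obtain x where "x \<in> D" "y = pr s x" by (auto simp: level_digits_def)
    then show "(\<Sum>z\<in>{z \<in> D. pr s z = y}. popt z) = 1 / Zt * Zl s y powr al s"
      using fibre_mass_popt[OF s] by (simp add: fibre_mass_def)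
  qed
  also have "\<dots> = 1 / Zt * Zt" by (simp add: Ztotal_def sum_distrib_left)
  finally show ?thesis using Ztotal_pos by simp
qed

text \<open>
  With \<open>\<lambda>\<^sub>l = ln n\<^sub>s / ln n\<^sub>l\<close> the first \<open>\<lambda>\<^sub>l k\<close> digits in base \<open>n\<^sub>l\<close> determine a coordinate with precision
  \<open>n\<^sub>s\<close> to the power \<open>- k\<close>.
\<close>

definition lam :: "nat \<Rightarrow> real" where
  "lam l = (if l = 0 then 0 else ln (real (n s)) / ln (real (n l)))"

lemma ln_n_pos: "l \<in> {1..s} \<Longrightarrow> 0 < ln (real (n l))"
  using n_ge_2[of l] by simp

lemma lam_less: "l \<in> {1..s} \<Longrightarrow> lam (l - 1) < lam l"
proof -
  assume l: "l \<in> {1..s}"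
  have s: "0 < ln (real (n s))" using s_pos by (intro ln_n_pos) auto
  show ?thesis
  proof (cases "l = 1")
    case False
    then have l1: "l - 1 \<in> {1..s}" "l \<noteq> 0" "l - 1 \<noteq> 0" using l by auto
    have "n l < n (l - 1)" using l by (intro n_less l1) auto
    then have "ln (real (n l)) < ln (real (n (l - 1)))" using n_ge_2[OF l] by simp
    then show ?thesis using s ln_n_pos[OF l] ln_n_pos[OF l1(1)] l1
      by (simp add: lam_def divide_strict_left_mono)
  qed (use s ln_n_pos[OF l] in \<open>simp add: lam_def\<close>)
qed

lemma lam_level_exp: "l \<in> {1..s} \<Longrightarrow> lam l * al l = lam (l - 1)"
  using ln_n_pos[of l] ln_n_pos[of "l - 1"] by (auto simp: lam_def level_exp_def)

text \<open>
  In the sum, the coefficient of \<open>ln (Z\<^sup>(\<^sup>i\<^sup>) (\<tau>\<^sub>i x))\<close> is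
  \<open>(\<lambda>\<^sub>i - \<lambda>\<^sub>i\<^sub>-\<^sub>1) \<alpha>\<^sub>i + \<lambda>\<^sub>i\<^sub>-\<^sub>1 (\<alpha>\<^sub>i - 1) = \<lambda>\<^sub>i \<alpha>\<^sub>i - \<lambda>\<^sub>i\<^sub>-\<^sub>1\<close>, and this vanishes. What remains is
  \<open>- ln Z\<close> times the total weight \<open>1\<close>. The induction below runs over partial sums; \<open>T\<close> collects the
  factors of the levels that are still to come.
\<close>

lemma popt_balance:
  assumes x: "x \<in> D"
  shows "(\<Sum>l=1..s. (lam l - lam (l - 1)) * ln (fibre_mass D (pr l) popt x)) = - ln Zt"
proof -
  define F where "F i = ln (Zl i (pr i x))" for i
  define T where "T l = (\<Sum>i=Suc l..s. (al i - 1) * F i)" for l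
  have Zp: "0 < Zl i (pr i x)" if "i \<in> {1..s}" for i
    using Zfun_pos[OF that] x by (auto simp: level_digits_def)
  have ln_mass: "ln (fibre_mass D (pr l) popt x) = - ln Zt + (al l * F l + T l)" if l: "l \<in> {1..s}" for l
  proof -
    define Q where "Q = (\<Prod>i=Suc l..s. Zl i (pr i x) powr (al i - 1))"
    have "ln Q = T l"
      unfolding Q_def T_def F_def using Zp by (subst ln_prod) (auto simp: ln_powr intro!: sum.cong less_imp_neq[symmetric])
    moreover have "0 < Q"
      unfolding Q_def using Zp by (intro prod_pos) (auto intro!: less_imp_neq[symmetric])
    ultimately show ?thesis
      unfolding fibre_mass_popt[OF l x] F_def Q_def[symmetric] using Ztotal_pos Zp[OF l]
      by (simp add: ln_mult ln_div ln_powr)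
  qed
  have "(\<Sum>l=1..r. (lam l - lam (l - 1)) * (al l * F l + T l)) = lam r * T r" if "r \<le> s" for r
    using that
  proof (induction r)
    case (Suc r)
    have T: "T r = (al (Suc r) - 1) * F (Suc r) + T (Suc r)"
      unfolding T_def using Suc.prems by (subst sum.atLeast_Suc_atMost) auto
    have "lam (Suc r) * al (Suc r) = lam r" using lam_level_exp[of "Suc r"] Suc.prems by simp
    then have la: "lam (Suc r) * (al (Suc r) * F (Suc r)) = lam r * F (Suc r)"
      by (simp only: mult.assoc[symmetric])
    have "(\<Sum>l=1..Suc r. (lam l - lam (l - 1)) * (al l * F l + T l))
        = lam r * T r + (lam (Suc r) - lam r) * (al (Suc r) * F (Suc r) + T (Suc r))"
      using Suc by simp
    also have "\<dots> = lam (Suc r) * (al (Suc r) * F (Suc r)) - lam r * F (Suc r) + lam (Suc r) * T (Suc r)"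
      unfolding T by (simp add: algebra_simps)
    finally show ?case unfolding la by simp
  qed (simp add: lam_def)
  from this[of s] have 1: "(\<Sum>l=1..s. (lam l - lam (l - 1)) * (al l * F l + T l)) = 0"
    by (simp add: T_def)
  have 2: "(\<Sum>l=1..r. lam l - lam (l - 1)) = lam r" for r
    by (induction r) (auto simp: lam_def)
  have 3: "lam s = 1" using ln_n_pos[of s] s_pos by (simp add: lam_def)
  have "(\<Sum>l=1..s. (lam l - lam (l - 1)) * ln (fibre_mass D (pr l) popt x))
      = (\<Sum>l=1..s. (lam l - lam (l - 1)) * - ln Zt + (lam l - lam (l - 1)) * (al l * F l + T l))"
    by (intro sum.cong refl) (simp add: ln_mass algebra_simps)
  also have "\<dots> = (\<Sum>l=1..s. lam l - lam (l - 1)) * - ln Zt"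
    unfolding sum.distrib 1 sum_distrib_right by simp
  finally show ?thesis unfolding 2 3 by simp
qed

sublocale lev: level_system D pr s lam popt "ln Zt"
proof
  show "lam s = 1" using ln_n_pos[of s] s_pos by (simp add: lam_def)
qed (use finite_D s_pos lam_less popt_pos popt_sum popt_balance in \<open>auto simp: lam_def\<close>)

text \<open>
  Since \<open>\<tau>\<^sub>l\<close> shows exactly the blocks from \<open>l\<close> on, the coordinates of block \<open>i\<close> are visible at all
  levels up to \<open>i\<close>, that is for all times below \<open>cut i k\<close>.
\<close>

lemma cube_word_eq_iff:
  fixes x y :: "nat \<Rightarrow> 'd \<Rightarrow> nat"
  shows "lev.cube_word k x = lev.cube_word k y \<longleftrightarrow> (\<forall>j. \<forall>t<lev.cut (block j) k. x t j = y t j)"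
proof
  assume eq: "lev.cube_word k x = lev.cube_word k y"
  show "\<forall>j. \<forall>t<lev.cut (block j) k. x t j = y t j"
  proof (intro allI impI)
    fix j :: 'd and t assume t: "t < lev.cut (block j) k"
    have bs: "block j \<le> s" using block(1)[of j] by simp
    have "t < k" using t lev.cut_mono[of "block j" s k] bs by simp
    then have "pr (lev.lev k t) (x t) = pr (lev.lev k t) (y t)"
      using fun_cong[OF eq, of t] by (simp add: lev.cube_word_def)
    moreover have "lev.lev k t \<le> block j" unfolding lev.lev_def by (rule Least_le) (rule t)
    then have "dd (lev.lev k t - 1) \<le> dd (block j - 1)" using bs by (intro dd_mono) auto
    then have "dd (lev.lev k t - 1) < position j" using block(2)[of j] by simp
    ultimately show "x t j = y t j" by (auto simp: level_proj_def dest!: fun_cong[of _ _ j])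
  qed
next
  assume agree: "\<forall>j. \<forall>t<lev.cut (block j) k. x t j = y t j"
  show "lev.cube_word k x = lev.cube_word k y"
    unfolding lev.cube_word_def
  proof (rule restrict_ext)
    fix t assume "t \<in> {..<k}"
    then have t: "t < k" by simp
    show "pr (lev.lev k t) (x t) = pr (lev.lev k t) (y t)"
      unfolding level_proj_def
    proof (rule restrict_ext)
      fix j :: 'd assume "j \<in> {j. dd (lev.lev k t - 1) < position j}"
      then have "dd (lev.lev k t - 1) < dd (block j)" using block(3)[of j] by simp
      moreover have "lev.lev k t - 1 \<le> s"
        using lev.lev_props(1)[OF t] unfolding atLeastAtMost_iff by linarith
      ultimately have "\<not> block j \<le> lev.lev k t - 1"
        using dd_mono[of "block j" "lev.lev k t - 1"] by auto
      then have "lev.lev k t \<le> block j" by simp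
      then have "lev.cut (lev.lev k t) k \<le> lev.cut (block j) k"
        using block(1)[of j] by (intro lev.cut_mono) auto
      then show "x t j = y t j" using agree lev.lev_props(3)[OF t] by auto
    qed
  qed
qed

text \<open>
  The sides of an approximate cube of scale \<open>k\<close> are comparable to \<open>n\<^sub>s\<close> to the power \<open>- k\<close>; the
  factor \<open>m j\<close> comes from rounding \<open>\<lambda>\<^sub>l k\<close> down.
\<close>

lemma power_cut_bounds:
  "real (m j) ^ lev.cut (block j) k \<le> real (n s) ^ k"
  "real (n s) ^ k \<le> real (m j) * real (m j) ^ lev.cut (block j) k"
proof -
  let ?L = "lev.cut (block j) k"
  have b: "block j \<le> s" "block j \<in> {1..s}" using block(1)[of j] by auto
  have n: "0 < real (n s)" using n_ge_2[of s] s_pos by simp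
  have mp: "0 < real (m j)" using m_ge_2[of j] by simp
  have lm: "0 < ln (real (m j))" unfolding m_eq using ln_n_pos b(2) by simp
  have lam: "lam (block j) * ln (real (m j)) = ln (real (n s))"
    using lm b(2) unfolding m_eq by (auto simp: lam_def)
  have "real ?L * ln (real (m j)) \<le> lam (block j) * real k * ln (real (m j))"
    using lev.cut_le[OF b(1)] lm by (intro mult_right_mono) auto
  also have "\<dots> = real k * ln (real (n s))" unfolding lam[symmetric] by simp
  finally have 1: "real ?L * ln (real (m j)) \<le> real k * ln (real (n s))" .
  have "(lam (block j) * real k - 1) * ln (real (m j)) \<le> real ?L * ln (real (m j))"
    using lev.cut_gt[OF b(1), of k] lm by (intro mult_right_mono) auto
  then have 2: "real k * ln (real (n s)) \<le> real (Suc ?L) * ln (real (m j))"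
    unfolding lam[symmetric] by (simp add: algebra_simps)
  show "real (m j) ^ ?L \<le> real (n s) ^ k"
    using 1 n mp by (subst ln_le_cancel_iff[symmetric]) (auto simp: ln_realpow)
  have "real (n s) ^ k \<le> real (m j) ^ Suc ?L"
    using 2 n mp by (subst ln_le_cancel_iff[symmetric]) (auto simp: ln_realpow simp del: power_Suc)
  then show "real (n s) ^ k \<le> real (m j) * real (m j) ^ ?L" by simp
qed

lemma digit_less: "x \<in> UNIV \<rightarrow> D \<Longrightarrow> x t j < m j"
  using D_digits by (auto simp: digits_def Pi_iff)

text \<open>
  A point within \<open>n\<^sub>s\<close> to the power \<open>- k\<close> of the image of \<open>x\<close> has, in each coordinate, an interval number
  that differs from that of \<open>x\<close> by at most \<open>2\<close> modulo the number of intervals. These differences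
  identify its approximate cube, which gives at most \<open>5\<close> to the power \<open>d\<close> cubes.
\<close>

sublocale code: coded_set D pr s lam popt "ln Zt" "sponge_map m" "real (n s)" "\<Sum>j\<in>UNIV. real (m j)" "5 ^ CARD('d)"
proof
  have ns: "2 \<le> n s" using s_pos by (intro n_ge_2) auto
  then show "1 < real (n s)" by simp
  show "0 < (\<Sum>j\<in>UNIV. real (m j))" using m_ge_2 by (intro sum_pos) (auto intro: less_le_trans[of 0 2])
  have powr: "real (n s) powr (- real k) = 1 / real (n s) ^ k" for k
    using ns by (simp add: powr_minus powr_realpow divide_inverse)
  have code: "sponge_map m x = torus_of (\<chi> j. base_value (m j) (\<lambda>t. x t j))" if "x \<in> UNIV \<rightarrow> D" for x
    using m_ge_2 digit_less[OF that] by (intro sponge_map_eq) auto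
  fix k :: nat and x :: "nat \<Rightarrow> 'd \<Rightarrow> nat"
  {
    fix y :: "nat \<Rightarrow> 'd \<Rightarrow> nat"
    assume x: "x \<in> UNIV \<rightarrow> D" and y: "y \<in> UNIV \<rightarrow> D" and eq: "lev.cube_word k x = lev.cube_word k y"
    let ?v = "\<lambda>x. \<chi> j. base_value (m j) (\<lambda>t. x t j)"
    have "dist (sponge_map m x) (sponge_map m y) \<le> dist (?v x) (?v y)"
      unfolding code[OF x] code[OF y] by (rule dist_torus_of_le)
    also have "\<dots> \<le> (\<Sum>j\<in>UNIV. \<bar>(?v x - ?v y) $ j\<bar>)" unfolding dist_norm by (rule norm_le_l1_cart)
    also have "\<dots> \<le> (\<Sum>j\<in>UNIV. real (m j) * (1 / real (n s) ^ k))"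
    proof (rule sum_mono)
      fix j
      let ?L = "lev.cut (block j) k"
      have mp: "0 < real (m j)" using m_ge_2[of j] by simp
      have "\<bar>(?v x - ?v y) $ j\<bar> \<le> 1 / real (m j) ^ ?L"
        using base_value_close[of "m j" "\<lambda>t. x t j" "\<lambda>t. y t j" ?L] m_ge_2 digit_less[OF x] digit_less[OF y]
          eq unfolding cube_word_eq_iff by simp
      also have "\<dots> \<le> real (m j) * (1 / real (n s) ^ k)"
        using power_cut_bounds(2)[where j=j and k=k] mp ns by (simp add: field_simps)
      finally show "\<bar>(?v x - ?v y) $ j\<bar> \<le> real (m j) * (1 / real (n s) ^ k)" .
    qed
    finally show "dist (sponge_map m x) (sponge_map m y) \<le> (\<Sum>j\<in>UNIV. real (m j)) * real (n s) powr (- real k)"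
      unfolding powr by (simp only: sum_distrib_right)
  }
  assume x: "x \<in> UNIV \<rightarrow> D"
  let ?S = "{y \<in> UNIV \<rightarrow> D. dist (sponge_map m y) (sponge_map m x) \<le> real (n s) powr (- real k)}"
  define pre where "pre y j = int (digit_prefix (m j) (\<lambda>t. y t j) (lev.cut (block j) k))" for y j
  define B where "B j = int (m j) ^ lev.cut (block j) k" for j
  have "\<exists>e. \<forall>j. e j \<in> {-2..2} \<and> (\<exists>z. pre y j = pre x j + z * B j + e j)" if "y \<in> ?S" for y
  proof -
    from that have y: "y \<in> UNIV \<rightarrow> D" and d: "dist (sponge_map m y) (sponge_map m x) \<le> real (n s) powr (- real k)"
      by auto
    have "\<exists>e. e \<in> {-2..2} \<and> (\<exists>z. pre y j = pre x j + z * B j + e)" for j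
    proof -
      let ?L = "lev.cut (block j) k"
      have "0 < real (n s) powr (- real k)" using ns by simp
      then have "dist (sponge_map m y) (sponge_map m x) < 2 * real (n s) powr (- real k)" using d by linarith
      then obtain z where "\<bar>base_value (m j) (\<lambda>t. y t j) - base_value (m j) (\<lambda>t. x t j) - of_int z\<bar>
          < 2 * real (n s) powr (- real k)"
        using dist_torus_of_less[where j=j] unfolding code[OF x] code[OF y] by fastforce
      also have "\<dots> \<le> 2 / real (m j) ^ ?L"
        using power_cut_bounds(1)[where j=j and k=k] m_ge_2[of j] ns unfolding powr by (simp add: frac_le)
      finally have "\<bar>pre y j - pre x j - z * B j\<bar> \<le> 2"
        unfolding pre_def B_def using m_ge_2 digit_less[OF x] digit_less[OF y] by (intro digit_prefix_near) auto
      then show ?thesis by (intro exI[of _ "pre y j - pre x j - z * B j"] conjI exI[of _ z]) auto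
    qed
    then show ?thesis by metis
  qed
  then have "\<forall>y\<in>?S. \<exists>e. \<forall>j. e j \<in> {-2..2} \<and> (\<exists>z. pre y j = pre x j + z * B j + e j)" ..
  from bchoice[OF this] obtain \<sigma> where
    sig: "\<forall>y\<in>?S. \<forall>j. \<sigma> y j \<in> {-2..2} \<and> (\<exists>z. pre y j = pre x j + z * B j + \<sigma> y j)" ..
  have \<sigma>: "\<sigma> y j \<in> {-2..2}" "\<exists>z. pre y j = pre x j + z * B j + \<sigma> y j" if "y \<in> ?S" for y j
    using sig that by blast+
  let ?F = "PiE (UNIV :: 'd set) (\<lambda>_. {-2..2 :: int})"
  have F: "finite ?F" "card ?F = 5 ^ CARD('d)" by (auto simp: finite_PiE card_PiE)
  have sub: "\<sigma> ` ?S \<subseteq> ?F" using \<sigma>(1) by (auto simp: PiE_def extensional_def)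
  have inj: "lev.cube_word k y = lev.cube_word k y'" if y: "y \<in> ?S" and y': "y' \<in> ?S" and eq: "\<sigma> y = \<sigma> y'" for y y'
    unfolding cube_word_eq_iff
  proof (intro allI impI)
    fix j :: 'd and t assume t: "t < lev.cut (block j) k"
    have less: "\<And>t. y t j < m j" "\<And>t. y' t j < m j" using y y' digit_less by auto
    obtain z z' where "pre y j = pre x j + z * B j + \<sigma> y j" "pre y' j = pre x j + z' * B j + \<sigma> y' j"
      using \<sigma>(2)[OF y] \<sigma>(2)[OF y'] by meson
    then have "pre y j = pre y' j + B j * (z - z')" using eq by (simp add: algebra_simps)
    then have "pre y j mod B j = pre y' j mod B j" by simp
    moreover have "0 \<le> pre y j" "pre y j < B j" "0 \<le> pre y' j" "pre y' j < B j"
      using digit_prefix_less[of "\<lambda>t. y t j" "m j" "lev.cut (block j) k", OF less(1)]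
        digit_prefix_less[of "\<lambda>t. y' t j" "m j" "lev.cut (block j) k", OF less(2)]
      unfolding pre_def B_def by (simp_all flip: of_nat_power)
    ultimately have "pre y j = pre y' j" by simp
    then have "digit_prefix (m j) (\<lambda>t. y t j) (lev.cut (block j) k) = digit_prefix (m j) (\<lambda>t. y' t j) (lev.cut (block j) k)"
      by (simp add: pre_def)
    from digit_prefix_inject[OF less this t] show "y t j = y' t j" .
  qed
  show "finite (lev.cube_word k ` ?S) \<and> card (lev.cube_word k ` ?S) \<le> 5 ^ CARD('d)"
    using card_image_le_signatures[where c="lev.cube_word k", OF F(1) sub inj] unfolding F(2) by (rule conjI)
qed

lemma level_push_eq: "level_push dd D i q (pr i x) = fibre_mass D (pr i) q x"
  by (simp add: level_push_def fibre_mass_def)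

text \<open>
  A probability vector is uniform iff it is constant, as its entries sum to \<open>1\<close>.
\<close>

lemma nonuniform_iff_fibre_mass_varies:
  assumes "i \<in> {1..s}"
  shows "\<not> uniform_vector (level_digits dd D i) (level_push dd D i popt)
    \<longleftrightarrow> (\<exists>x\<in>D. \<exists>y\<in>D. fibre_mass D (pr i) popt x \<noteq> fibre_mass D (pr i) popt y)"
proof -
  let ?B = "level_digits dd D i" and ?q = "level_push dd D i popt"
  have sum1: "(\<Sum>y\<in>?B. ?q y) = 1"
    unfolding level_push_def popt_sum[symmetric]
    using finite_D by (intro sum.group) (auto simp: level_digits_def)
  have const: "uniform_vector ?B ?q \<longleftrightarrow> (\<forall>y\<in>?B. \<forall>y'\<in>?B. ?q y = ?q y')"
  proof
    assume c: "\<forall>y\<in>?B. \<forall>y'\<in>?B. ?q y = ?q y'"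
    show "uniform_vector ?B ?q"
      unfolding uniform_vector_def
    proof
      fix y assume y: "y \<in> ?B"
      have "1 = (\<Sum>y'\<in>?B. ?q y)" 
        unfolding sum1[symmetric] by (intro sum.cong refl) (use c y in blast)
      then have "1 = real (card ?B) * ?q y" by simp
      moreover from this have "real (card ?B) \<noteq> 0" by (metis mult_zero_left zero_neq_one)
      ultimately show "?q y = 1 / real (card ?B)" by (simp add: field_simps)
    qed
  qed (auto simp: uniform_vector_def)
  have "(\<forall>y\<in>?B. \<forall>y'\<in>?B. ?q y = ?q y') \<longleftrightarrow> (\<forall>x\<in>D. \<forall>x'\<in>D. ?q (pr i x) = ?q (pr i x'))"
    unfolding level_digits_def by blast
  then show ?thesis unfolding const level_push_eq by blast
qed

end

theorem proposition6p6:
  fixes m :: "'d::{finite,linorder} \<Rightarrow> nat"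
    and D :: "('d \<Rightarrow> nat) set"
    and s :: nat
    and n dd :: "nat \<Rightarrow> nat"
  assumes m_decreasing: "antimono m"
    and m_ge_2: "\<And>j. 2 \<le> m j"
    and s_eq: "s = card (range m)"
    and n_decreasing: "strict_antimono_on {1..s} n"
    and dd_increasing: "strict_mono_on {0..s} dd"
    and dd_0: "dd 0 = 0"
    and dd_s: "dd s = CARD('d)"
    and blocks: "\<And>i j. i \<in> {1..s} \<Longrightarrow> dd (i - 1) < position j \<Longrightarrow> position j \<le> dd i \<Longrightarrow> m j = n i"
    and D_nonempty: "D \<noteq> {}"
    and D_digits: "D \<subseteq> digits m"
    and nonuniform_ge_1:
      "1 \<le> card {i \<in> {1..s}.
         \<not> uniform_vector (level_digits dd D i) (level_push dd D i (opt_vector n dd s D))}"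
    and nonuniform_le_2:
      "card {i \<in> {1..s}.
         \<not> uniform_vector (level_digits dd D i) (level_push dd D i (opt_vector n dd s D))} \<le> 2"
  shows "hausdorff_measure (hausdorff_dim (sponge m D)) (sponge m D) = \<infinity>"
proof -
  have "1 \<le> s" unfolding s_eq by (simp add: Suc_le_eq card_gt_0_iff)
  interpret sponge_blocks m D s n dd
    by unfold_locales
       (fact m_ge_2 \<open>1 \<le> s\<close> n_decreasing dd_increasing dd_0 dd_s blocks D_nonempty D_digits)+
  have eq: "{i \<in> {1..s}. \<not> uniform_vector (level_digits dd D i) (level_push dd D i popt)}
      = {i \<in> {1..s}. \<exists>x\<in>D. \<exists>y\<in>D. fibre_mass D (pr i) popt x \<noteq> fibre_mass D (pr i) popt y}"
    by (rule Collect_cong) (simp only: nonuniform_iff_fibre_mass_varies cong: conj_cong)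
  obtain a b where "a \<in> D" "b \<in> D" "0 < lev.gain a b"
    using lev.positive_gain_exists[OF nonuniform_ge_1[unfolded eq] nonuniform_le_2[unfolded eq]]
    by (elim bexE)
  then show ?thesis unfolding sponge_def by (rule code.hausdorff_measure_dim_infinite)
qed

end
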